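(* The function $D$ is strictly decreasing on the real interval $(0,1)$. Consequently, $\rho_0$ is the unique real zero of $D$.
   Context: Here $\zeta$ is the Riemann zeta function. $D$ is the function given by $D(s)=\sum_{n\ge1}\zeta(2n)\,n^{-s}$ for $\operatorname{Re}(s)>1$, continued meromorphically to $\mathbb{C}$ by $D(s)=\zeta(s)+E(s)$, where $E(s)=\sum_{n\ge1}(\zeta(2n)-1)n^{-s}$ converges absolutely for all $s\in\mathbb{C}$ and is entire; the only singularity of $D$ is a simple pole at $s=1$. $D$ is real on the real axis away from $s=1$. The symbol $\rho_0$ denotes a zero of $D$ in the interval $(0,1)$ (such a zero exists; numerically $\rho_0=0.200411339\cdots$). "Real zero of $D$" means a zero in $\mathbb{R}\setminus\{1\}$. *)

theory Defs
  imports "HOL-Complex_Analysis.Complex_Analysis"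
begin

text \<open>
  The Riemann zeta function, as the holomorphic continuation of its Dirichlet series to the
  complex plane without 1. The connectedness of that domain makes the continuation unique
  there; the value at the pole is fixed to 0 only so that the description is unique.
\<close>

definition zeta :: "complex \<Rightarrow> complex" where
  "zeta = (THE f. f holomorphic_on (- {1}) \<and>
                  (\<forall>s. Re s > 1 \<longrightarrow> (\<lambda>n. of_nat (Suc n) powr (- s)) sums f s) \<and>
                  f 1 = 0)"

text \<open>Both series start at 1, hence the shifted index.\<close>

definition E :: "complex \<Rightarrow> complex" where
  "E s = (\<Sum>n. (zeta (of_nat (2 * Suc n)) - 1) * of_nat (Suc n) powr (- s))"

text \<open>
  For real part greater than 1, this is the sum of the Dirichlet series with coefficients
  \<open>zeta (2 * n)\<close>; the value at the pole 1 is a dummy.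
\<close>

definition D :: "complex \<Rightarrow> complex" where
  "D s = zeta s + E s"

end

theory Submission
  imports Defs
begin

text \<open>
  Jensen's formula represents zeta on the whole plane: with \<open>w t = pi / 2 / (cosh (pi t))\<^sup>2\<close>,
  \<open>(s - 1) zeta s\<close> is the integral of \<open>w t * (1/2 + it) powr (1 - s)\<close> over the real line.
  It follows by moving the line of integration across the integers \<open>m\<close>, where the kernel
  \<open>1 / (sin (pi z))\<^sup>2\<close> has double poles; each crossing contributes \<open>(s - 1) m powr (- s)\<close>.

  For \<open>0 < p < q < 1\<close> and \<open>z = 1/2 + it\<close> the mean value theorem gives
  \<open>Re (z powr q) - Re (z powr p) \<le> (q - p) (t\<^sup>2 - 3/16)\<close>. The kernel has mass 1 and second moment
  at most 1/9, so \<open>- p zeta (1 - p)\<close> decreases in \<open>p\<close>; it is nonnegative, whence zeta decreases on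
  the unit interval, and \<open>E\<close> decreases termwise.

  For \<open>y \<ge> 0\<close> the formula bounds \<open>(1 + y) |zeta (- y)|\<close> by the integral of
  \<open>w t * |1/2 + it| powr (1 + y)\<close>. Its part over \<open>|t| \<le> 1\<close> is smaller than \<open>1 + y\<close> times the first two
  terms of \<open>E (- y)\<close>, and its part over \<open>k \<le> |t| \<le> k + 1\<close> is at most \<open>1 + y\<close> times the term with
  index \<open>k + 2\<close>. Hence \<open>D > 0\<close> on the nonpositive axis, and \<open>D > 0\<close> right of 1 is clear.
\<close>

subsection \<open>Averages against the hyperbolic secant kernel\<close>

text \<open>On every line whose real part is a half-integer this is
  \<open>pi / 2 / (sin (pi z))^2\<close>, as a function of the height. The factor
  \<open>pi / 2\<close> normalises the total mass to 1.\<close>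

definition sech2_kernel :: "real \<Rightarrow> real" where
  "sech2_kernel t = pi / 2 / (cosh (pi * t))\<^sup>2"

lemma sech2_kernel_pos: "sech2_kernel t > 0"
  by (simp add: sech2_kernel_def)

lemma sech2_kernel_minus [simp]: "sech2_kernel (- t) = sech2_kernel t"
  by (simp add: sech2_kernel_def)

lemma sech2_kernel_le: "sech2_kernel t \<le> 2 * pi * exp (- (2 * pi * \<bar>t\<bar>))"
proof -
  have "exp (pi * \<bar>t\<bar>) / 2 \<le> cosh (pi * \<bar>t\<bar>)"
    by (simp add: cosh_field_def)
  also have "\<dots> = cosh (pi * t)"
    by (simp add: abs_if)
  finally have "(exp (pi * \<bar>t\<bar>) / 2)\<^sup>2 \<le> (cosh (pi * t))\<^sup>2"
    by (intro power_mono) auto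
  then have "pi / 2 / (cosh (pi * t))\<^sup>2 \<le> pi / 2 / (exp (pi * \<bar>t\<bar>) / 2)\<^sup>2"
    by (intro divide_left_mono) (auto intro!: mult_pos_pos)
  also have "\<dots> = 2 * pi * exp (- (2 * pi * \<bar>t\<bar>))"
    by (simp add: power2_eq_square exp_minus field_simps flip: exp_add)
  finally show ?thesis
    by (simp add: sech2_kernel_def)
qed

lemma continuous_on_sech2_kernel [continuous_intros]:
  "continuous_on A f \<Longrightarrow> continuous_on A (\<lambda>t. sech2_kernel (f t))"
  unfolding sech2_kernel_def by (intro continuous_intros) auto

lemma sech2_kernel_has_integral:
  assumes "a \<le> b"
  shows "(sech2_kernel has_integral (tanh (pi * b) / 2 - tanh (pi * a) / 2)) {a..b}"
proof (rule fundamental_theorem_of_calculus[OF assms])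
  fix t :: real
  have "1 - (tanh (pi * t))\<^sup>2 = 1 / (cosh (pi * t))\<^sup>2"
    by (simp add: tanh_def power_divide sinh_square_eq diff_divide_distrib)
  then have "sech2_kernel t = (1 - (tanh (pi * t))\<^sup>2) * pi / 2"
    by (simp add: sech2_kernel_def)
  then have "((\<lambda>t. tanh (pi * t) / 2) has_real_derivative sech2_kernel t) (at t within {a..b})"
    by (auto intro!: derivative_eq_intros)
  then show "((\<lambda>t. tanh (pi * t) / 2) has_vector_derivative sech2_kernel t) (at t within {a..b})"
    by (simp add: has_real_derivative_iff_has_vector_derivative)
qed

text \<open>The growth rate in \<open>t\<close> is 1 whatever \<open>s\<close> is; the dependence on
  \<open>s\<close> goes into the constant. The kernel decays at rate \<open>2 * pi\<close>, so it
  wins uniformly for \<open>s\<close> in a disc.\<close>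

lemma powr_line_bound:
  fixes s :: complex
  assumes "norm s \<le> R" "1 / 2 \<le> a"
  shows "norm (Complex a t powr (1 - s)) \<le>
           exp (2 + a + (R + 1) * ln (R + 1) + R * pi) * exp \<bar>t\<bar>"
proof -
  define z where "z = Complex a t"
  \<comment> \<open>The summand 2 ensures \<open>1 / y <= 1 / 2 <= norm z\<close>, so
    \<open>ln y\<close> bounds the logarithm of \<open>norm z\<close> from both sides.\<close>
  define y where "y = 2 + a + \<bar>t\<bar>"
  have R: "R \<ge> 0"
    using assms norm_ge_zero[of s] by linarith
  have a: "a > 0" "y > 0"
    using assms by (auto simp: y_def)
  have z: "z \<noteq> 0"
    using a by (auto simp: z_def complex_eq_iff)
  have "norm z \<ge> 1 / 2"
    using abs_Re_le_cmod[of z] assms by (simp add: z_def)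
  moreover have "norm z \<le> a + \<bar>t\<bar>"
    using cmod_le[of z] a by (simp add: z_def)
  moreover have "1 / y \<le> 1 / 2"
    using assms by (auto simp: y_def)
  ultimately have n: "1 / y \<le> norm z" "norm z \<le> y"
    unfolding y_def by linarith+
  have "\<bar>ln (norm z)\<bar> \<le> ln y"
  proof -
    have "ln (1 / y) \<le> ln (norm z)" "ln (norm z) \<le> ln y"
      using n a z by (subst ln_le_cancel_iff; auto)+
    then show ?thesis
      using a by (simp add: ln_div)
  qed
  \<comment> \<open>A tangent to the logarithm, chosen so that multiplication by the exponent bound
    \<open>R + 1\<close> gives exactly \<open>y\<close> plus a constant.\<close>
  also have "ln y \<le> y / (R + 1) + ln (R + 1)"
    using ln_le_minus_one[of "y / (R + 1)"] a R by (simp add: ln_div)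
  finally have ln: "\<bar>ln (norm z)\<bar> \<le> y / (R + 1) + ln (R + 1)" .
  have "\<bar>1 - Re s\<bar> \<le> R + 1" "\<bar>Im s\<bar> \<le> R"
    using abs_Re_le_cmod[of s] abs_Im_le_cmod[of s] assms by linarith+
  then have 1: "\<bar>1 - Re s\<bar> * \<bar>ln (norm z)\<bar> \<le> (R + 1) * (y / (R + 1) + ln (R + 1))"
    and 2: "\<bar>Im s\<bar> * \<bar>Im (Ln z)\<bar> \<le> R * pi"
    using ln R mpi_less_Im_Ln[OF z] Im_Ln_le_pi[OF z] by (auto intro!: mult_mono)
  have "Re ((1 - s) * Ln z) = (1 - Re s) * ln (norm z) + Im s * Im (Ln z)"
    using z by simp
  also have "\<dots> \<le> \<bar>(1 - Re s) * ln (norm z)\<bar> + \<bar>Im s * Im (Ln z)\<bar>"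
    by linarith
  also have "\<dots> \<le> (R + 1) * (y / (R + 1) + ln (R + 1)) + R * pi"
    using 1 2 by (simp add: abs_mult)
  also have "\<dots> = y + (R + 1) * ln (R + 1) + R * pi"
    using R by (simp add: field_simps)
  finally have "exp (Re ((1 - s) * Ln z)) \<le> exp (y + (R + 1) * ln (R + 1) + R * pi)"
    by simp
  moreover have "norm (z powr (1 - s)) = exp (Re ((1 - s) * Ln z))"
    using z by (simp add: powr_def)
  ultimately show ?thesis
    by (simp add: z_def y_def add_ac flip: exp_add)
qed

lemma kernel_powr_line_bound:
  fixes s :: complex
  assumes "norm s \<le> R" "1 / 2 \<le> a"
  shows "norm (sech2_kernel t * (Complex a t powr (1 - s))) \<le>
           2 * pi * exp (2 + a + (R + 1) * ln (R + 1) + R * pi) * exp (- \<bar>t\<bar>)"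
proof -
  have "sech2_kernel t \<le> 2 * pi * exp (- (2 * \<bar>t\<bar>))"
  proof -
    have "2 * \<bar>t\<bar> \<le> 2 * pi * \<bar>t\<bar>"
      using mult_right_mono[of 2 "2 * pi" "\<bar>t\<bar>"] pi_gt3 by simp
    then have "2 * pi * exp (- (2 * pi * \<bar>t\<bar>)) \<le> 2 * pi * exp (- (2 * \<bar>t\<bar>))"
      by (intro mult_left_mono) auto
    then show ?thesis
      using sech2_kernel_le[of t] by linarith
  qed
  then have "sech2_kernel t * norm (Complex a t powr (1 - s)) \<le>
     2 * pi * exp (- (2 * \<bar>t\<bar>)) * (exp (2 + a + (R + 1) * ln (R + 1) + R * pi) * exp \<bar>t\<bar>)"
    using powr_line_bound[OF assms, of t] sech2_kernel_pos[of t] by (intro mult_mono) auto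
  also have "\<dots> = 2 * pi * exp (2 + a + (R + 1) * ln (R + 1) + R * pi) * exp (- \<bar>t\<bar>)"
    by (simp flip: exp_add)
  finally show ?thesis
    using sech2_kernel_pos[of t] by (simp add: norm_mult)
qed

lemma exp_minus_nat_LIMSEQ: "(\<lambda>n. C * exp (- real n)) \<longlonglongrightarrow> 0"
proof (rule tendsto_mult_right_zero)
  show "(\<lambda>n. exp (- real n)) \<longlonglongrightarrow> 0"
    by (intro filterlim_compose[OF exp_at_bot]
        filterlim_compose[OF filterlim_uminus_at_bot_at_top] filterlim_real_sequentially)
qed

lemma tanh_pi_LIMSEQ: "(\<lambda>n. tanh (pi * real n)) \<longlonglongrightarrow> 1"
  by (intro filterlim_compose[OF tanh_real_at_top]
      filterlim_tendsto_pos_mult_at_top[OF tendsto_const] filterlim_real_sequentially) auto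

text \<open>Enlarging a symmetric interval adds two outer pieces, each dominated by the tail of
  \<open>C * exp (- t)\<close> beyond \<open>a\<close>.\<close>

lemma integral_exponential_tail:
  fixes F :: "real \<Rightarrow> complex"
  assumes F: "continuous_on UNIV F" and bound: "\<And>t. norm (F t) \<le> C * exp (- \<bar>t\<bar>)"
    and "0 \<le> a" "a \<le> b"
  shows "norm (integral {-b..b} F - integral {-a..a} F) \<le> 2 * C * exp (- a)"
proof -
  have int: "F integrable_on {u..v}" for u v
    using F by (intro integrable_continuous_real) (auto intro: continuous_on_subset)
  have C: "C \<ge> 0"
    using bound[of 0] norm_ge_zero[of "F 0"] by (simp del: norm_ge_zero)
  have tail: "integral {a..b} (\<lambda>t. C * exp (- t)) \<le> C * exp (- a)"
    and tail_int: "(\<lambda>t. C * exp (- t)) integrable_on {a..b}"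
  proof -
    have "((\<lambda>t. C * exp (- t)) has_integral (- (C * exp (- b)) - - (C * exp (- a)))) {a..b}"
    proof (rule fundamental_theorem_of_calculus[OF \<open>a \<le> b\<close>])
      fix t
      have "((\<lambda>t. - (C * exp (- t))) has_real_derivative C * exp (- t)) (at t within {a..b})"
        by (auto intro!: derivative_eq_intros)
      then show "((\<lambda>t. - (C * exp (- t))) has_vector_derivative C * exp (- t)) (at t within {a..b})"
        by (simp add: has_real_derivative_iff_has_vector_derivative)
    qed
    from this[unfolded has_integral_iff] show "integral {a..b} (\<lambda>t. C * exp (- t)) \<le> C * exp (- a)"
      "(\<lambda>t. C * exp (- t)) integrable_on {a..b}"
      using C by auto
  qed
  have "norm (integral {a..b} F) \<le> integral {a..b} (\<lambda>t. C * exp (- t))"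
    using assms by (intro integral_norm_bound_integral int tail_int order.trans[OF bound]) auto
  moreover have "norm (integral {-b..-a} F) \<le> integral {a..b} (\<lambda>t. C * exp (- t))"
  proof -
    have "norm (integral {a..b} (\<lambda>t. F (- t))) \<le> integral {a..b} (\<lambda>t. C * exp (- t))"
      using assms
      by (intro integral_norm_bound_integral tail_int integrable_continuous_real
            continuous_intros continuous_on_compose2[OF F] order.trans[OF bound]) auto
    then show ?thesis
      using Henstock_Kurzweil_Integration.integral_reflect_real[of b a "\<lambda>t. F (- t)"] by simp
  qed
  moreover have "integral {-b..b} F = integral {-b..-a} F + integral {-a..a} F + integral {a..b} F"
    using Henstock_Kurzweil_Integration.integral_combine[OF _ _ int, of "-b" "-a" b]
      Henstock_Kurzweil_Integration.integral_combine[OF _ _ int, of "-a" a b] assms by (simp add: add.assoc)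
  then have "norm (integral {-b..b} F - integral {-a..a} F) \<le> norm (integral {-b..-a} F) + norm (integral {a..b} F)"
    using norm_triangle_ineq[of "integral {-b..-a} F" "integral {a..b} F"] by simp
  ultimately show ?thesis
    using tail by linarith
qed

section \<open>Truncated means along vertical lines and their limit\<close>

definition line_mean :: "complex \<Rightarrow> real \<Rightarrow> nat \<Rightarrow> complex" where
  "line_mean s a N =
     integral {- real N..real N} (\<lambda>t. sech2_kernel t * (Complex a t powr (1 - s)))"

lemma Complex_eq_line: "Complex a t = of_real a + of_real t * \<i>"
  by (simp add: complex_eq_iff)

lemma continuous_on_line [continuous_intros]: "continuous_on A (\<lambda>t. Complex a t)"
  unfolding Complex_eq_line by (intro continuous_intros)

lemma continuous_on_kernel_powr_line:
  assumes "a > 0"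
  shows "continuous_on A (\<lambda>t. sech2_kernel t * (Complex a t powr (1 - s)))"
  using assms by (intro continuous_intros) (auto simp: complex_nonpos_Reals_iff complex_eq_iff)

text \<open>Truncation at integers makes the improper integral the limit of a sequence. This limit
  will be \<open>(s - 1) * zeta s\<close>, with the pole cancelled.\<close>

definition entire_mean :: "complex \<Rightarrow> complex" where
  "entire_mean s = lim (line_mean s (1 / 2))"

lemma line_mean_tail:
  assumes "norm s \<le> R" "1 / 2 \<le> a" "M \<le> N"
  shows "norm (line_mean s a N - line_mean s a M) \<le>
           4 * pi * exp (2 + a + (R + 1) * ln (R + 1) + R * pi) * exp (- real M)"
  unfolding line_mean_def
  by (rule order.trans, rule integral_exponential_tail[OF continuous_on_kernel_powr_line
      kernel_powr_line_bound[OF assms(1,2)]]) (use assms in auto)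

lemma line_mean_convergent:
  assumes "1 / 2 \<le> a"
  shows "convergent (line_mean s a)"
proof -
  define C where "C = 4 * pi * exp (2 + a + (norm s + 1) * ln (norm s + 1) + norm s * pi)"
  show ?thesis
  proof (rule Cauchy_convergent, rule CauchyI')
    fix e :: real assume "e > 0"
    then have "\<forall>\<^sub>F M in sequentially. C * exp (- real M) < e"
      by (rule order_tendstoD(2)[OF exp_minus_nat_LIMSEQ])
    then obtain M0 where "\<And>M. M \<ge> M0 \<Longrightarrow> C * exp (- real M) < e"
      by (auto simp: eventually_sequentially)
    then show "\<exists>M. \<forall>m\<ge>M. \<forall>n>m. dist (line_mean s a m) (line_mean s a n) < e"
      using line_mean_tail[OF order.refl assms, where s = s] unfolding C_def[symmetric] dist_norm
      by (metis less_imp_le norm_minus_commute order.strict_trans1)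
  qed
qed

lemma entire_mean_LIMSEQ: "line_mean s (1 / 2) \<longlonglongrightarrow> entire_mean s"
  unfolding entire_mean_def using line_mean_convergent by (simp add: convergent_LIMSEQ_iff)

lemma line_mean_holomorphic:
  assumes "a > 0"
  shows "(\<lambda>s. line_mean s a N) holomorphic_on UNIV"
  unfolding line_mean_def 
proof (subst box_real(2)[symmetric], rule leibniz_rule_holomorphic)
  define f' where "f' = (\<lambda>s t. - (sech2_kernel t * (Complex a t powr (1 - s) * Ln (Complex a t))))"
  have nz: "Complex a t \<noteq> 0" for t
    using assms by (auto simp: complex_eq_iff)
  show "((\<lambda>s. sech2_kernel t * (Complex a t powr (1 - s))) has_field_derivative f' s t) (at s within UNIV)" for s t
    unfolding f'_def using nz[of t]
    by (auto intro!: derivative_eq_intros has_field_derivative_powr_right[THEN DERIV_chain2])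
  show "continuous_on (UNIV \<times> cbox (- real N) (real N)) (\<lambda>(s, t). f' s t)"
    unfolding f'_def case_prod_unfold Complex_eq_line using assms
    by (intro continuous_intros) (auto simp: complex_nonpos_Reals_iff complex_eq_iff)
  show "(\<lambda>t. sech2_kernel t * (Complex a t powr (1 - s))) integrable_on cbox (- real N) (real N)" for s
    by (intro integrable_continuous continuous_on_kernel_powr_line assms)
qed auto

text \<open>The tail bound depends on \<open>s\<close> only through a bound on its norm, so the
  truncated means converge locally uniformly and holomorphy passes to the limit.\<close>

lemma entire_mean_holomorphic: "entire_mean holomorphic_on UNIV"
proof (rule holomorphic_uniform_sequence)
  fix z :: complex
  define R where "R = norm z + 1"
  define C where "C = 4 * pi * exp (2 + 1/2 + (R + 1) * ln (R + 1) + R * pi)"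
  have "norm (line_mean s (1/2) M - entire_mean s) \<le> C * exp (- real M)" if "s \<in> cball z 1" for s M
  proof (rule tendsto_upperbound)
    have "norm s \<le> R"
      using that norm_triangle_ineq2[of s z] by (simp add: R_def dist_norm norm_minus_commute)
    then show "\<forall>\<^sub>F N in sequentially. norm (line_mean s (1/2) M - line_mean s (1/2) N) \<le> C * exp (- real M)"
      unfolding eventually_sequentially C_def
      by (metis line_mean_tail norm_minus_commute order.refl)
    show "(\<lambda>N. norm (line_mean s (1/2) M - line_mean s (1/2) N)) \<longlonglongrightarrow> norm (line_mean s (1/2) M - entire_mean s)"
      by (intro tendsto_intros entire_mean_LIMSEQ)
  qed auto
  then have "uniform_limit (cball z 1) (\<lambda>N s. line_mean s (1/2) N) entire_mean sequentially"
    unfolding uniform_limit_iff dist_norm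
    using order_tendstoD(2)[OF exp_minus_nat_LIMSEQ[of C]] by (blast intro: eventually_mono order.strict_trans1)
  then show "\<exists>d>0. cball z d \<subseteq> UNIV \<and> uniform_limit (cball z d) (\<lambda>N s. line_mean s (1/2) N) entire_mean sequentially"
    by (intro exI[of _ 1]) auto
qed (auto intro: line_mean_holomorphic)

subsection \<open>Jensen's formula and the continuation of zeta\<close>

text \<open>Controls the horizontal edges at height N or -N: the numerator grows at most like
  \<open>exp N\<close>, while the squared modulus of the sine is at least
  \<open>exp (2 * N) / 4\<close>.\<close>

lemma horizontal_strip_bound:
  fixes s :: complex
  assumes m: "m \<ge> (1::nat)" and N: "N \<ge> (1::nat)" and T: "\<bar>T\<bar> = real N"
    and x: "real m - 1 / 2 \<le> x" "x \<le> real m + 1 / 2"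
    and g: "g * sin (of_real pi * Complex x T) ^ 2 = Complex x T powr (1 - s) - u - v * (Complex x T - of_nat m)"
  shows "norm g \<le> 4 * (exp (2 + (m + 1 / 2) + (norm s + 1) * ln (norm s + 1) + norm s * pi) + norm u + norm v) * exp (- real N)"
proof -
  define K where "K = exp (2 + (m + 1 / 2) + (norm s + 1) * ln (norm s + 1) + norm s * pi)"
  define z where "z = Complex x T"
  have e: "exp (real N) \<ge> 1 + real N" "1 + real N \<ge> 2"
    using N by auto
  have "norm (z powr (1 - s)) \<le> exp (2 + x + (norm s + 1) * ln (norm s + 1) + norm s * pi) * exp \<bar>T\<bar>"
    unfolding z_def by (rule powr_line_bound) (use m x in auto)
  also have "\<dots> \<le> K * exp (real N)"
    unfolding K_def T using x by (intro mult_right_mono) auto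
  finally have 1: "norm (z powr (1 - s)) \<le> K * exp (real N)" .
  have 2: "norm u \<le> norm u * exp (real N)"
    using mult_left_mono[of 1 "exp (real N)" "norm u"] by simp
  have "norm (z - of_nat m) \<le> \<bar>x - real m\<bar> + \<bar>T\<bar>"
    using cmod_le[of "z - of_nat m"] by (simp add: z_def)
  also have "\<dots> \<le> exp (real N)"
    using x T e by linarith
  finally have 3: "norm (v * (z - of_nat m)) \<le> norm v * exp (real N)"
    unfolding norm_mult by (intro mult_left_mono) auto
  have "norm (z powr (1 - s) - u - v * (z - of_nat m)) \<le> norm (z powr (1 - s)) + norm u + norm (v * (z - of_nat m))"
    by (intro norm_triangle_le_diff add_mono order.refl)
  then have num: "norm (z powr (1 - s) - u - v * (z - of_nat m)) \<le> (K + norm u + norm v) * exp (real N)"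
    using 1 2 3 by (simp add: algebra_simps)
  have "exp (2 * real N) * 2 \<le> exp (2 * real N) * exp (real N)"
    using order.trans[OF e(2) e(1)] by (intro mult_left_mono) auto
  also have "\<dots> = exp (3 * real N)"
    by (simp flip: exp_add)
  also have "\<dots> \<le> exp (2 * (pi * real N))"
    using mult_right_mono[of 3 "2 * pi" "real N"] pi_gt3 by simp
  finally have 4: "2 * exp (2 * real N) \<le> exp (2 * (pi * real N))" by simp
  have 5: "exp (2 * real N) \<ge> 2"
    using exp_ge_add_one_self[of "2 * real N"] N by linarith
  have "norm (sin (of_real pi * z)) ^ 2 =
      (exp (2 * (pi * T)) + exp (- (2 * (pi * T))) - 2 * cos (2 * (pi * x))) / 4"
    by (simp add: norm_sin_squared z_def exp_minus)
  also have "exp (2 * (pi * T)) + exp (- (2 * (pi * T))) = exp (2 * (pi * real N)) + exp (- (2 * (pi * real N)))"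
    by (cases "T \<ge> 0") (simp_all flip: T)
  finally have sin: "norm (sin (of_real pi * z)) ^ 2 =
      (exp (2 * (pi * real N)) + exp (- (2 * (pi * real N))) - 2 * cos (2 * (pi * x))) / 4" .
  \<comment> \<open>The leading exponential is at least two copies of \<open>exp (2 * N)\<close>;
    one copy is at least 2 and absorbs the cosine term.\<close>
  have "norm (sin (of_real pi * z)) ^ 2 \<ge> exp (2 * real N) / 4"
  proof -
    have "D / 4 \<le> (A + B - 2 * c) / 4" if "2 * D \<le> A" "2 \<le> D" "c \<le> 1" "0 < B" for A B c D :: real
      using that by simp
    from this[OF 4 5 cos_le_one exp_gt_zero] show ?thesis
      unfolding sin .
  qed
  then have "norm g * (exp (2 * real N) / 4) \<le> norm g * norm (sin (of_real pi * z)) ^ 2"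
    by (intro mult_left_mono) auto
  also have "\<dots> \<le> (K + norm u + norm v) * exp (real N)"
    using num g by (simp add: z_def flip: norm_power norm_mult)
  finally have "norm g * exp (2 * real N) * exp (- (2 * real N)) \<le>
      4 * (K + norm u + norm v) * exp (real N) * exp (- (2 * real N))"
    by (intro mult_right_mono) (auto simp: algebra_simps)
  then show ?thesis
    by (simp add: K_def mult.assoc flip: exp_add)
qed

text \<open>At odd multiples of \<open>pi / 2\<close> the cosine vanishes and the sine is 1 or -1.
  Squaring removes the sign, so all these lines carry the same kernel.\<close>

lemma sin_half_integer_line:
  "sin (of_real pi * Complex (real_of_int k + 1 / 2) t) ^ 2 = of_real ((cosh (pi * t))\<^sup>2)"
proof -
  have "cos (pi * (real_of_int k + 1 / 2)) = 0"
    by (subst cos_zero_iff_int) (auto simp: algebra_simps intro!: exI[of _ "2 * k + 1"])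
  moreover have "sin (pi * (real_of_int k + 1 / 2)) ^ 2 = 1"
    using calculation sin_squared_eq[of "pi * (real_of_int k + 1 / 2)"] by simp
  moreover have "sin (of_real pi * Complex (real_of_int k + 1 / 2) t) =
      of_real (sin (pi * (real_of_int k + 1 / 2)) * cosh (pi * t))"
    by (rule complex_eqI)
       (use calculation(1) in \<open>simp_all add: Re_sin Im_sin cosh_field_def\<close>)
  ultimately show ?thesis
    by (simp add: power_mult_distrib flip: of_real_power)
qed

text \<open>The remainder after the linear Taylor polynomial vanishes at \<open>m\<close> to order
  at least two, the squared sine to order exactly two, and the sine has no other zero in the strip.
  The product form remains valid at \<open>m\<close> itself.\<close>

lemma removable_double_pole:
  assumes m: "m \<ge> (1::nat)"
    and f: "f holomorphic_on {z. real m - 1 < Re z \<and> Re z < real m + 1}" (is "f holomorphic_on ?S")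
  obtains g where "g holomorphic_on {z. real m - 1 < Re z \<and> Re z < real m + 1}"
    "\<And>z. real m - 1 < Re z \<Longrightarrow> Re z < real m + 1 \<Longrightarrow>
       g z * sin (of_real pi * z) ^ 2 = f z - f (of_nat m) - deriv f (of_nat m) * (z - of_nat m)"
proof -
  let ?m = "of_nat m :: complex"
  have S: "open ?S"
    using open_Int[OF open_halfspace_Re_gt[of "real m - 1"] open_halfspace_Re_lt[of "real m + 1"]]
    by (simp add: Collect_conj_eq)
  \<comment> \<open>Two divided differences strip the double zero from the remainder of
    \<open>f\<close>, and one strips the simple zero from the sine; the witness is the quotient of
    \<open>d2\<close> by the square of \<open>q\<close>.\<close>
  define d1 where "d1 = (\<lambda>z. if z = ?m then deriv f ?m else (f z - f ?m) / (z - ?m))"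
  define d2 where "d2 = (\<lambda>z. if z = ?m then deriv d1 ?m else (d1 z - d1 ?m) / (z - ?m))"
  define h where "h = (\<lambda>z::complex. sin (of_real pi * z))"
  define q where "q = (\<lambda>z. if z = ?m then deriv h ?m else (h z - h ?m) / (z - ?m))"
  have d1: "d1 holomorphic_on ?S"
    unfolding d1_def by (rule pole_lemma_open[OF f S])
  have d2: "d2 holomorphic_on ?S"
    unfolding d2_def by (rule pole_lemma_open[OF d1 S])
  have q: "q holomorphic_on ?S"
    unfolding q_def by (rule pole_lemma_open[OF _ S]) (auto simp: h_def intro!: holomorphic_intros)
  have hm: "h ?m = 0"
    unfolding h_def by (auto simp: sin_eq_0 intro: exI[of _ "int m"])
  have dh: "deriv h ?m = of_real pi * cos (of_real pi * ?m)"
    unfolding h_def by (rule DERIV_imp_deriv) (auto intro!: derivative_eq_intros)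
  have "cos (of_real pi * ?m) \<noteq> 0"
    using hm sin_cos_squared_add[of "of_real pi * ?m"] by (auto simp: h_def)
  then have "q ?m \<noteq> 0"
    by (simp add: q_def dh)
  have qz: "q z \<noteq> 0" if "z \<in> ?S" for z
  proof (cases "z = ?m")
    case False
    have "h z \<noteq> 0"
    proof
      assume "h z = 0"
      then obtain n :: int where n: "of_real pi * z = of_real (of_int n * pi)"
        unfolding h_def by (auto simp: sin_eq_0)
      then have "z = of_int n"
        by (simp add: mult.commute)
      with that have "real_of_int n > real m - 1" "real_of_int n < real m + 1"
        by auto
      then have "n = int m" by linarith
      with \<open>z = of_int n\<close> False show False by simp
    qed
    then show ?thesis
      using False hm by (simp add: q_def)
  qed (use \<open>q ?m \<noteq> 0\<close> in simp)
  show ?thesis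
  proof
    show "(\<lambda>z. d2 z / q z ^ 2) holomorphic_on ?S"
      using qz by (intro holomorphic_intros d2 q) auto
    fix z assume z: "real m - 1 < Re z" "Re z < real m + 1"
    show "d2 z / q z ^ 2 * sin (of_real pi * z) ^ 2 = f z - f ?m - deriv f ?m * (z - ?m)"
    proof (cases "z = ?m")
      case True
      then show ?thesis
        using hm by (simp add: h_def)
    next
      case False
      have "sin (of_real pi * z) = q z * (z - ?m)"
        using False hm by (simp add: q_def h_def)
      moreover have "d2 z * (z - ?m) = d1 z - deriv f ?m" "d1 z * (z - ?m) = f z - f ?m"
        using False by (simp_all add: d2_def d1_def)
      then have "d2 z * (z - ?m) ^ 2 = f z - f ?m - deriv f ?m * (z - ?m)"
        by (metis (no_types, opaque_lifting) left_diff_distrib mult.assoc power2_eq_square)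
      ultimately show ?thesis
        using qz[of z] z by (simp add: power_mult_distrib)
    qed
  qed
qed

text \<open>Both lines carry the same kernel, so the difference is a contour integral around the
  double pole at \<open>m\<close>. Its residue shows up as the slope of the linear Taylor
  polynomial, whose averages on lines one unit apart differ by slope times mass.\<close>

lemma line_mean_shift:
  assumes m: "m \<ge> (1::nat)"
  shows "(\<lambda>N. line_mean s (real m - 1 / 2) N - line_mean s (real m + 1 / 2) N)
           \<longlonglongrightarrow> (s - 1) * of_nat m powr (- s)"
proof -
  define S where "S = {z. real m - 1 < Re z \<and> Re z < real m + 1}"
  define f where "f = (\<lambda>z::complex. z powr (1 - s))"
  have f: "f holomorphic_on S"
    unfolding f_def S_def using m
    by (intro holomorphic_intros) (auto simp: complex_nonpos_Reals_iff)
  have f': "deriv f (of_nat m) = (1 - s) * of_nat m powr (- s)"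
    using has_field_derivative_powr[of "of_nat m" "1 - s"] m
    unfolding f_def by (intro DERIV_imp_deriv) (auto simp: complex_nonpos_Reals_iff)
  obtain g where g: "g holomorphic_on S" and geq: "\<And>z. real m - 1 < Re z \<Longrightarrow> Re z < real m + 1 \<Longrightarrow>
       g z * sin (of_real pi * z) ^ 2 = f z - f (of_nat m) - deriv f (of_nat m) * (z - of_nat m)"
    by (rule removable_double_pole[OF m f[unfolded S_def], folded S_def])
      (rule that)
  have S: "open S" "convex S"
    using open_Int[OF open_halfspace_Re_gt[of "real m - 1"] open_halfspace_Re_lt[of "real m + 1"]]
      convex_Int[OF convex_halfspace_Re_gt[of "real m - 1"] convex_halfspace_Re_lt[of "real m + 1"]]
    by (simp_all add: S_def Collect_conj_eq)
  obtain P where P': "\<And>z. z \<in> S \<Longrightarrow> (P has_field_derivative g z) (at z within S)"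
    using holomorphic_convex_primitive'[OF S(2,1) g] by blast
  then have P: "(P has_field_derivative g z) (at z)" if "z \<in> S" for z
    using that S(1) by (metis at_within_open)
  define c where "c = deriv f (of_nat m)"
  define K where "K = 4 * (exp (2 + (m + 1 / 2) + (norm s + 1) * ln (norm s + 1) + norm s * pi) + norm (f (of_nat m)) + norm c)"
  \<comment> \<open>Each horizontal edge has length 1, so a bound for \<open>g\<close> along it also
    bounds the increment of its primitive.\<close>
  have horizontal: "norm (P (Complex (m + 1 / 2) T) - P (Complex (m - 1 / 2) T)) \<le> K * exp (- real N)"
    if "N \<ge> 1" "\<bar>T\<bar> = real N" for N T
  proof -
    define L where "L = {z. Re z \<in> {m - 1 / 2..m + 1 / 2} \<and> Im z = T}"
    have "norm (P (Complex (m + 1 / 2) T) - P (Complex (m - 1 / 2) T)) \<le> 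
        K * exp (- real N) * norm (Complex (m + 1 / 2) T - Complex (m - 1 / 2) T)"
    proof (rule field_differentiable_bound)
      have "L = {z. Re z \<ge> m - 1 / 2} \<inter> {z. Re z \<le> m + 1 / 2} \<inter> {z. Im z \<ge> T} \<inter> {z. Im z \<le> T}"
        by (auto simp: L_def)
      then show "convex L"
        by (simp add: convex_Int convex_halfspace_Re_ge convex_halfspace_Re_le convex_halfspace_Im_ge convex_halfspace_Im_le)
      fix z assume z: "z \<in> L"
      then have "z \<in> S"
        by (auto simp: L_def S_def)
      then show "(P has_field_derivative g z) (at z within L)"
        using P has_field_derivative_at_within by blast
      have "z = Complex (Re z) T"
        using z by (auto simp: L_def complex_eq_iff)
      then show "norm (g z) \<le> K * exp (- real N)"
        unfolding K_def using z that m geq[of z] \<open>z \<in> S\<close>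
        by (intro horizontal_strip_bound[of m N T "Re z"]) (auto simp: f_def c_def S_def L_def)
    qed (auto simp: L_def)
    also have "Complex (m + 1 / 2) T - Complex (m - 1 / 2) T = 1"
      by (simp add: complex_eq_iff)
    finally show ?thesis by simp
  qed
  txt \<open>The affine part of the Taylor expansion at \<open>m\<close> is averaged exactly; its odd part contributes
    the same amount on both vertical lines. What remains is a removable singularity, so the
    difference of the two lines is read off a primitive.\<close>
  have vertical: "line_mean s a N = of_real (tanh (pi * N)) * (f (of_nat m) + c * (a - of_nat m))
        + c * \<i> * integral {-real N..real N} (\<lambda>t. of_real (sech2_kernel t * t))
        - of_real (pi / 2) * \<i> * (P (Complex a N) - P (Complex a (- real N)))"
    if a: "a = real m - 1 / 2 \<or> a = real m + 1 / 2" for a N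
  proof -
    have inS: "Complex a t \<in> S" for t
      using a by (auto simp: S_def)
    have "((\<lambda>t. g (Complex a t) * \<i>) has_integral (P (Complex a N) - P (Complex a (- real N)))) {-real N..real N}"
    proof (rule fundamental_theorem_of_calculus)
      fix t
      have "((\<lambda>t. Complex a t) has_vector_derivative \<i>) (at t within {-real N..real N})"
        unfolding Complex_eq_line by (auto intro!: derivative_eq_intros simp: has_vector_derivative_def scaleR_conv_of_real)
      from field_vector_diff_chain_within[OF this, where g = P and g' = "g (Complex a t)"]
      show "((\<lambda>t. P (Complex a t)) has_vector_derivative g (Complex a t) * \<i>) (at t within {-real N..real N})"
        using has_field_derivative_at_within[OF P[OF inS]] by (simp add: o_def mult.commute)
    qed auto
    from has_integral_mult_right[OF this, of "- of_real (pi / 2) * \<i>"]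
    have G: "((\<lambda>t. of_real (pi / 2) * g (Complex a t)) has_integral (- of_real (pi / 2) * \<i> * (P (Complex a N) - P (Complex a (- real N))))) {-real N..real N}"
      by (simp add: mult_ac)
    have W: "((\<lambda>t. of_real (sech2_kernel t) * (f (of_nat m) + c * (a - of_nat m))) has_integral
         of_real (tanh (pi * N)) * (f (of_nat m) + c * (a - of_nat m))) {-real N..real N}"
      using has_integral_mult_left[OF has_integral_of_real[OF sech2_kernel_has_integral[of "-real N" "real N"], where 'b = complex]]
      by simp
    have "(\<lambda>t. of_real (sech2_kernel t * t) :: complex) integrable_on {-real N..real N}"
      by (intro integrable_continuous_real continuous_intros)
    then have X: "((\<lambda>t. c * \<i> * of_real (sech2_kernel t * t)) has_integral
         c * \<i> * integral {-real N..real N} (\<lambda>t. of_real (sech2_kernel t * t))) {-real N..real N}"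
      by (intro has_integral_mult_right integrable_integral)
    have "of_real (sech2_kernel t) * f (Complex a t) =
        of_real (sech2_kernel t) * (f (of_nat m) + c * (a - of_nat m)) + c * \<i> * of_real (sech2_kernel t * t)
        + of_real (pi / 2) * g (Complex a t)" for t
    proof -
      have "\<exists>k::int. a = k + 1 / 2"
        using a by (auto intro: exI[of _ "int m - 1"] exI[of _ "int m"])
      then have "sin (of_real pi * Complex a t) ^ 2 = of_real ((cosh (pi * t))\<^sup>2)"
        using sin_half_integer_line by auto
      then have f_eq: "f (Complex a t) = f (of_nat m) + c * (Complex a t - of_nat m) + g (Complex a t) * of_real ((cosh (pi * t))\<^sup>2)"
        using geq[of "Complex a t"] inS[of t] by (simp add: S_def c_def algebra_simps)
      have "sech2_kernel t * (cosh (pi * t))\<^sup>2 = pi / 2"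
        by (simp add: sech2_kernel_def)
      then have w: "of_real (sech2_kernel t) * (of_real ((cosh (pi * t))\<^sup>2) :: complex) = of_real (pi / 2)"
        by (metis of_real_mult)
      have "of_real (sech2_kernel t) * f (Complex a t) =
         of_real (sech2_kernel t) * (f (of_nat m) + c * (Complex a t - of_nat m))
         + (of_real (sech2_kernel t) * of_real ((cosh (pi * t))\<^sup>2)) * g (Complex a t)"
        unfolding f_eq by (simp only: ring_distribs mult_ac)
      also have "of_real (sech2_kernel t) * of_real ((cosh (pi * t))\<^sup>2) = (of_real (pi / 2) :: complex)"
        by (rule w)
      finally have "of_real (sech2_kernel t) * f (Complex a t) =
         of_real (sech2_kernel t) * (f (of_nat m) + c * (Complex a t - of_nat m)) + of_real (pi / 2) * g (Complex a t)" .
      then show ?thesis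
        by (simp add: Complex_eq_line algebra_simps)
    qed
    then have "((\<lambda>t. of_real (sech2_kernel t) * f (Complex a t)) has_integral
        of_real (tanh (pi * N)) * (f (of_nat m) + c * (a - of_nat m))
        + c * \<i> * integral {-real N..real N} (\<lambda>t. of_real (sech2_kernel t * t))
        + (- of_real (pi / 2) * \<i> * (P (Complex a N) - P (Complex a (- real N))))) {-real N..real N}"
      using has_integral_add[OF has_integral_add[OF W X] G] by simp
    then show ?thesis
      unfolding line_mean_def f_def by (simp add: integral_unique)
  qed
  define H where "H = (\<lambda>T. P (Complex (m + 1 / 2) T) - P (Complex (m - 1 / 2) T))"
  \<comment> \<open>The first-moment terms cancel, and the four corner values of \<open>P\<close>
    regroup into increments along the two horizontal edges, which vanish in the limit.\<close>
  have diff: "line_mean s (real m - 1 / 2) N - line_mean s (real m + 1 / 2) N =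
      - c * of_real (tanh (pi * N)) + of_real (pi / 2) * \<i> * (H N - H (- real N))" for N
    by (subst (1 2) vertical) (auto simp: H_def algebra_simps)
  have "(\<lambda>N. H (real N) - H (- real N)) \<longlonglongrightarrow> 0"
  proof (rule Lim_null_comparison)
    show "\<forall>\<^sub>F N in sequentially. norm (H (real N) - H (- real N)) \<le> 2 * K * exp (- real N)"
      using eventually_ge_at_top[of 1]
    proof eventually_elim
      case (elim N)
      then show ?case
        using horizontal[of N "real N"] horizontal[of N "- real N"]
          norm_triangle_ineq4[of "H (real N)" "H (- real N)"] by (simp add: H_def)
    qed
    show "(\<lambda>N. 2 * K * exp (- real N)) \<longlonglongrightarrow> 0"
      by (rule exp_minus_nat_LIMSEQ)
  qed
  moreover note tanh_pi_LIMSEQ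
  ultimately have "(\<lambda>N. - c * of_real (tanh (pi * N)) + of_real (pi / 2) * \<i> * (H N - H (- real N))) \<longlonglongrightarrow>
     - c * of_real 1 + of_real (pi / 2) * \<i> * 0"
    by (intro tendsto_intros)
  then show ?thesis
    unfolding diff c_def f' by (simp add: left_diff_distrib)
qed

text \<open>The exponent \<open>1 - Re s\<close> is nonpositive and \<open>norm z >= a\<close>, the
  argument contributes at most \<open>exp (\<bar>Im s\<bar> * pi)\<close>, and the mass is below 1.
  For \<open>Re s > 1\<close> the bound tends to 0 as the line moves to the right.\<close>

lemma line_mean_norm_le:
  assumes "1 / 2 \<le> a" "Re s \<ge> 1"
  shows "norm (line_mean s a N) \<le> a powr (1 - Re s) * exp (\<bar>Im s\<bar> * pi)"
proof -
  have "norm (line_mean s a N) \<le> integral {- real N..real N} (\<lambda>t. sech2_kernel t * (a powr (1 - Re s) * exp (\<bar>Im s\<bar> * pi)))"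
    unfolding line_mean_def
  proof (rule integral_norm_bound_integral)
    show "(\<lambda>t. sech2_kernel t * (Complex a t powr (1 - s))) integrable_on {- real N..real N}"
      using assms by (intro integrable_continuous_real continuous_on_kernel_powr_line) auto
    show "(\<lambda>t. sech2_kernel t * (a powr (1 - Re s) * exp (\<bar>Im s\<bar> * pi))) integrable_on {- real N..real N}"
      by (intro integrable_continuous_real continuous_intros)
    fix t
    let ?z = "Complex a t"
    have z: "?z \<noteq> 0" "a > 0"
      using assms by (auto simp: complex_eq_iff)
    have "ln a \<le> ln (norm ?z)"
      using abs_Re_le_cmod[of ?z] z by (subst ln_le_cancel_iff) auto
    then have 1: "(1 - Re s) * ln (norm ?z) \<le> (1 - Re s) * ln a"
      using assms by (intro mult_left_mono_neg) auto
    have "\<bar>Im (Ln ?z)\<bar> \<le> pi"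
      using mpi_less_Im_Ln[OF z(1)] Im_Ln_le_pi[OF z(1)] by linarith
    then have "\<bar>Im s * Im (Ln ?z)\<bar> \<le> \<bar>Im s\<bar> * pi"
      unfolding abs_mult by (intro mult_left_mono) auto
    then have "exp (Re ((1 - s) * Ln ?z)) \<le> exp ((1 - Re s) * ln a + \<bar>Im s\<bar> * pi)"
      using 1 z by simp
    then have "norm (?z powr (1 - s)) \<le> a powr (1 - Re s) * exp (\<bar>Im s\<bar> * pi)"
      using z by (simp add: powr_def exp_add)
    then show "norm (of_real (sech2_kernel t) * (?z powr (1 - s))) \<le> sech2_kernel t * (a powr (1 - Re s) * exp (\<bar>Im s\<bar> * pi))"
      using sech2_kernel_pos[of t] by (simp add: norm_mult)
  qed
  also have "\<dots> = tanh (pi * real N) * (a powr (1 - Re s) * exp (\<bar>Im s\<bar> * pi))"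
    using has_integral_mult_left[OF sech2_kernel_has_integral[of "-real N" "real N"]]
    by (intro integral_unique) simp
  also have "\<dots> \<le> 1 * (a powr (1 - Re s) * exp (\<bar>Im s\<bar> * pi))"
    using tanh_real_lt_1[of "pi * real N"] by (intro mult_right_mono) auto
  finally show ?thesis by simp
qed

text \<open>Telescopes the shift over the lines with real part \<open>k + 1/2\<close>: the means
  tend to 0 far to the right, so the jumps sum to the mean on the first line.\<close>

lemma entire_mean_sums:
  assumes "Re s > 1"
  shows "(\<lambda>n. (s - 1) * of_nat (Suc n) powr (- s)) sums entire_mean s"
proof -
  define L where "L = (\<lambda>k. lim (line_mean s (real k + 1 / 2)))"
  have L: "line_mean s (real k + 1 / 2) \<longlonglongrightarrow> L k" for k
    unfolding L_def using line_mean_convergent[of "real k + 1 / 2" s] by (simp add: convergent_LIMSEQ_iff)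
  define B where "B = (\<lambda>k. (real k + 1 / 2) powr (1 - Re s) * exp (\<bar>Im s\<bar> * pi))"
  have L_le: "norm (L k) \<le> B k" for k
    unfolding B_def
    by (rule tendsto_upperbound[OF tendsto_norm[OF L]])
       (use assms in \<open>auto intro!: always_eventually line_mean_norm_le\<close>)
  have "filterlim (\<lambda>k. 1 / 2 + real k) at_top sequentially"
    by (rule filterlim_tendsto_add_at_top[OF tendsto_const filterlim_real_sequentially])
  then have "(\<lambda>k. (real k + 1 / 2) powr (1 - Re s)) \<longlonglongrightarrow> 0"
    using assms by (intro tendsto_neg_powr) (auto simp: add.commute)
  then have "B \<longlonglongrightarrow> 0"
    unfolding B_def by (rule tendsto_mult_left_zero)
  then have "L \<longlonglongrightarrow> 0"
    by (rule Lim_null_comparison[rotated]) (simp add: L_le)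
  then have "(\<lambda>k. L k - L (Suc k)) sums (L 0 - 0)"
    by (rule telescope_sums')
  moreover have "L k - L (Suc k) = (s - 1) * of_nat (Suc k) powr (- s)" for k
    using LIMSEQ_unique[OF line_mean_shift[of "Suc k" s]] tendsto_diff[OF L[of k] L[of "Suc k"]]
    by (simp add: add_ac)
  moreover have "L 0 = entire_mean s"
    by (simp add: L_def entire_mean_def)
  ultimately show ?thesis by simp
qed

section \<open>Identification with the zeta function\<close>

lemma zeta_unique:
  assumes "f holomorphic_on (- {1})" "\<forall>s. Re s > 1 \<longrightarrow> (\<lambda>n. of_nat (Suc n) powr (- s)) sums f s" "f 1 = 0"
    and "g holomorphic_on (- {1})" "\<forall>s. Re s > 1 \<longrightarrow> (\<lambda>n. of_nat (Suc n) powr (- s)) sums g s" "g 1 = (0 :: complex)"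
  shows "f = g"
proof
  fix z :: complex
  show "f z = g z"
  proof (cases "z = 1")
    case False
    show ?thesis
    proof (rule analytic_continuation_open[where f = f and g = g and s = "{s. Re s > 1}" and s' = "- {1}"])
      show "f w = g w" if "w \<in> {s. Re s > 1}" for w
        using assms(2,5) that sums_unique2 by (metis mem_Collect_eq)
      show "{s. Re s > 1} \<noteq> {}"
        by (auto intro: exI[of _ 2])
      show "connected (- {1 :: complex})"
        by (rule connected_punctured_universe) simp
    qed (use False assms in \<open>auto intro: open_halfspace_Re_gt\<close>)
  qed (use assms in simp)
qed

text \<open>The right-hand side satisfies all three clauses of the definite description, and the
  identity theorem makes it the only such function.\<close>

lemma zeta_eq: "zeta s = (if s = 1 then 0 else entire_mean s / (s - 1))"
proof -
  define f where "f = (\<lambda>s. if s = 1 then 0 else entire_mean s / (s - 1))"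
  have f: "f holomorphic_on (- {1})"
  proof (rule holomorphic_transform)
    show "(\<lambda>s. entire_mean s / (s - 1)) holomorphic_on (- {1})"
      using entire_mean_holomorphic by (auto intro!: holomorphic_intros elim: holomorphic_on_subset)
  qed (auto simp: f_def)
  have sums: "\<forall>s. Re s > 1 \<longrightarrow> (\<lambda>n. of_nat (Suc n) powr (- s)) sums f s"
  proof safe
    fix s :: complex assume "Re s > 1"
    then have "s \<noteq> 1" by auto
    then show "(\<lambda>n. of_nat (Suc n) powr (- s)) sums f s"
      using sums_divide[OF entire_mean_sums[OF \<open>Re s > 1\<close>], of "s - 1"] by (simp add: f_def)
  qed
  have "f 1 = 0"
    by (simp add: f_def)
  have "zeta = f"
    unfolding zeta_def
  proof (rule the_equality)
    fix g assume "g holomorphic_on (- {1}) \<and>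
        (\<forall>s. Re s > 1 \<longrightarrow> (\<lambda>n. of_nat (Suc n) powr (- s)) sums g s) \<and> g 1 = 0"
    then show "g = f"
      by (intro zeta_unique[OF _ _ _ f sums \<open>f 1 = 0\<close>]) blast+
  qed (use f sums \<open>f 1 = 0\<close> in blast)
  then have "zeta s = f s"
    by simp
  then show ?thesis
    unfolding f_def .
qed

lemma zeta_sums:
  assumes "Re s > 1"
  shows "(\<lambda>n. of_nat (Suc n) powr (- s)) sums zeta s"
proof -
  have "s \<noteq> 1"
    using assms by auto
  then show ?thesis
    using sums_divide[OF entire_mean_sums[OF assms], of "s - 1"] by (simp add: zeta_eq)
qed

text \<open>At \<open>s = 1\<close> the power is constantly 1, so only the mass of the kernel
  remains. This is the residue of zeta at its pole.\<close>

lemma entire_mean_1: "entire_mean 1 = 1"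
proof -
  have "line_mean 1 (1 / 2) = (\<lambda>N. of_real (tanh (pi * real N)))"
  proof
    fix N
    have "Complex (1 / 2) t \<noteq> 0" for t
      by (auto simp: complex_eq_iff)
    then show "line_mean 1 (1 / 2) N = of_real (tanh (pi * real N))"
      using has_integral_of_real[OF sech2_kernel_has_integral[of "-real N" "real N"], where 'b = complex]
      unfolding line_mean_def by (intro integral_unique) simp
  qed
  moreover have "(\<lambda>N. of_real (tanh (pi * real N)) :: complex) \<longlonglongrightarrow> of_real 1"
    by (intro tendsto_of_real tanh_pi_LIMSEQ)
  ultimately show ?thesis
    using LIMSEQ_unique[OF entire_mean_LIMSEQ[of 1]] by simp
qed

subsection \<open>The real axis\<close>

text \<open>The exponent \<open>p\<close> is \<open>1 - s\<close> for real \<open>s\<close>; for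
  nonzero \<open>p\<close> the limit in \<open>N\<close> is
  \<open>- p * zeta (1 - p)\<close>.\<close>

definition critical_mean :: "real \<Rightarrow> nat \<Rightarrow> real" where
  "critical_mean p N = integral {- real N..real N} (\<lambda>t. sech2_kernel t * Re (Complex (1 / 2) t powr of_real p))"

text \<open>Conjugation reflects the line in the real axis and the kernel is even, so the mean
  equals its own conjugate.\<close>

lemma line_mean_real: "line_mean (of_real s) (1 / 2) N = of_real (critical_mean (1 - s) N)"
proof (rule complex_eqI)
  have int: "(\<lambda>t. sech2_kernel t * (Complex (1 / 2) t powr (1 - of_real s))) integrable_on {- real N..real N}"
    by (intro integrable_continuous_real continuous_on_kernel_powr_line) auto
  show "Re (line_mean (of_real s) (1 / 2) N) = Re (of_real (critical_mean (1 - s) N))"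
    using integral_linear[OF int bounded_linear_Re]
    by (simp add: line_mean_def critical_mean_def o_def)
  have "cnj (line_mean (of_real s) (1 / 2) N) = line_mean (of_real s) (1 / 2) N"
  proof -
    let ?F = "\<lambda>t. sech2_kernel t * (Complex (1 / 2) t powr (1 - of_real s))"
    have "cnj (integral {- real N..real N} ?F) = integral {- real N..real N} (cnj \<circ> ?F)"
      using integral_linear[OF int bounded_linear_cnj] by simp
    also have "cnj \<circ> ?F = (\<lambda>t. ?F (- t))"
    proof
      fix t
      have "cnj (Complex (1 / 2) t) = Complex (1 / 2) (- t)"
        by (simp add: complex_eq_iff)
      then show "(cnj \<circ> ?F) t = ?F (- t)"
        by (simp add: cnj_powr)
    qed
    also have "integral {- real N..real N} (\<lambda>t. ?F (- t)) = integral {- real N..real N} ?F"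
      using Henstock_Kurzweil_Integration.integral_reflect_real[of "real N" "- real N" ?F] by simp
    finally show ?thesis
      by (simp add: line_mean_def)
  qed
  then show "Im (line_mean (of_real s) (1 / 2) N) = Im (of_real (critical_mean (1 - s) N))"
    by (simp add: complex_eq_iff)
qed

lemma entire_mean_real:
  obtains M where "entire_mean (of_real s) = of_real M" "critical_mean (1 - s) \<longlonglongrightarrow> M"
proof
  have lim: "(\<lambda>N. of_real (critical_mean (1 - s) N)) \<longlonglongrightarrow> entire_mean (of_real s)"
    using entire_mean_LIMSEQ[of "of_real s"] by (simp add: line_mean_real[abs_def])
  then have "Im (entire_mean (of_real s)) = 0"
    using LIMSEQ_unique[OF tendsto_Im[OF lim]] by simp
  then show "entire_mean (of_real s) = of_real (Re (entire_mean (of_real s)))"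
    by (simp add: complex_eq_iff)
  show "critical_mean (1 - s) \<longlonglongrightarrow> Re (entire_mean (of_real s))"
    using tendsto_Re[OF lim] by simp
qed

section \<open>Moment and power estimates on the line with real part 1/2\<close>

lemma exp_moment_bound:
  fixes c :: real
  assumes "c > 0" "0 \<le> T"
  shows "integral {0..T} (\<lambda>t. t\<^sup>2 * (c * exp (- (c * t)))) \<le> 2 / c\<^sup>2"
proof -
  \<comment> \<open>The antiderivative from two integrations by parts; its value at \<open>T\<close>
    is nonpositive and its value at 0 supplies the bound.\<close>
  define F where "F = (\<lambda>t::real. - (exp (- (c * t)) * (t\<^sup>2 + 2 * t / c + 2 / c\<^sup>2)))"
  have "((\<lambda>t. t\<^sup>2 * (c * exp (- (c * t)))) has_integral (F T - F 0)) {0..T}"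
  proof (rule fundamental_theorem_of_calculus[OF assms(2)])
    fix t
    have "(F has_real_derivative t\<^sup>2 * (c * exp (- (c * t)))) (at t within {0..T})"
      unfolding F_def using assms
      by (auto intro!: derivative_eq_intros simp: field_simps power2_eq_square)
    then show "(F has_vector_derivative t\<^sup>2 * (c * exp (- (c * t)))) (at t within {0..T})"
      by (simp add: has_real_derivative_iff_has_vector_derivative)
  qed
  then have "integral {0..T} (\<lambda>t. t\<^sup>2 * (c * exp (- (c * t)))) = F T - F 0"
    by (rule integral_unique)
  moreover have "F T \<le> 0" "F 0 = - (2 / c\<^sup>2)"
    using assms by (simp_all add: F_def)
  ultimately show ?thesis by linarith
qed

text \<open>The exponential majorant gives \<open>2 / (2 * pi)^2\<close>, and
  \<open>2 * pi >= 6\<close> turns this into 1/18.\<close>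

lemma sech2_kernel_half_moment: "integral {0..real N} (\<lambda>t. sech2_kernel t * t\<^sup>2) \<le> 1 / 18"
proof -
  have "integral {0..real N} (\<lambda>t. sech2_kernel t * t\<^sup>2) \<le> integral {0..real N} (\<lambda>t. t\<^sup>2 * (2 * pi * exp (- (2 * pi * t))))"
  proof (rule integral_le)
    fix t :: real assume "t \<in> {0..real N}"
    then show "sech2_kernel t * t\<^sup>2 \<le> t\<^sup>2 * (2 * pi * exp (- (2 * pi * t)))"
      using mult_left_mono[OF sech2_kernel_le[of t], of "t\<^sup>2"] by (simp add: mult.commute)
  qed (intro integrable_continuous_real continuous_intros)+
  also have "\<dots> \<le> 2 / (2 * pi)\<^sup>2"
    by (rule exp_moment_bound) auto
  also have "\<dots> \<le> 2 / 6\<^sup>2"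
    using pi_gt3 by (intro divide_left_mono power_mono) auto
  finally show ?thesis by simp
qed

lemma integral_even:
  fixes f :: "real \<Rightarrow> real"
  assumes "continuous_on UNIV f" "\<And>t. f (- t) = f t" "0 \<le> a"
  shows "integral {-a..a} f = 2 * integral {0..a} f"
proof -
  have int: "f integrable_on {u..v}" for u v
    using assms(1) by (intro integrable_continuous_real) (auto intro: continuous_on_subset)
  have "integral {-a..a} f = integral {-a..0} f + integral {0..a} f"
    using Henstock_Kurzweil_Integration.integral_combine[OF _ _ int, of "-a" 0 a] assms by simp
  also have "integral {-a..0} f = integral {0..a} f"
    using Henstock_Kurzweil_Integration.integral_reflect_real[of a 0 f] assms(2) by simp
  finally show ?thesis by simp
qed

lemma sech2_kernel_moment: "integral {- real N..real N} (\<lambda>t. sech2_kernel t * t\<^sup>2) \<le> 1 / 9"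
  using sech2_kernel_half_moment[of N]
  by (subst integral_even) (auto intro!: continuous_intros)

text \<open>On the nonnegative side, \<open>ln (cos (p * t)) - p * ln (cos t)\<close> starts at 0
  and has derivative \<open>p * (tan t - tan (p * t)) >= 0\<close>; evenness covers negative
  \<open>x\<close>.\<close>

lemma cos_powr_le:
  assumes "0 \<le> p" "p \<le> 1" "\<bar>x\<bar> < pi / 2"
  shows "cos x powr p \<le> cos (p * x)"
proof -
  have *: "cos x powr p \<le> cos (p * x)" if x: "0 \<le> x" "x < pi / 2" for x
  proof -
    have cp: "cos (p * t) > 0 \<and> cos t > 0 \<and> 0 \<le> p * t \<and> p * t \<le> t" if "0 \<le> t" "t \<le> x" for t
    proof -
      have "0 \<le> p * t" "p * t \<le> t"
        using assms that mult_left_le_one_le[of t p] by auto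
      then show ?thesis
        using that x by (auto intro!: cos_gt_zero_pi)
    qed
    have "ln (cos (p * 0)) - p * ln (cos 0) \<le> ln (cos (p * x)) - p * ln (cos x)"
    proof (rule DERIV_nonneg_imp_nondecreasing[OF x(1)])
      fix t assume t: "0 \<le> t" "t \<le> x"
      have "((\<lambda>t. ln (cos (p * t)) - p * ln (cos t)) has_real_derivative p * (tan t - tan (p * t))) (at t)"
        using cp[OF t] by (auto intro!: derivative_eq_intros simp: tan_def field_simps)
      moreover have "tan (p * t) \<le> tan t"
        using cp[OF t] t x by (intro tan_mono_le) auto
      ultimately show "\<exists>y. ((\<lambda>t. ln (cos (p * t)) - p * ln (cos t)) has_real_derivative y) (at t) \<and> y \<ge> 0"
        using assms by (intro exI[of _ "p * (tan t - tan (p * t))"]) auto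
    qed
    then have "p * ln (cos x) \<le> ln (cos (p * x))" by simp
    then have "exp (p * ln (cos x)) \<le> exp (ln (cos (p * x)))" by simp
    then show ?thesis
      using cp[of x] x by (simp add: powr_def)
  qed
  show ?thesis
    using *[of x] *[of "- x"] assms by (cases "x \<ge> 0") auto
qed

text \<open>With modulus r and argument th, \<open>r * cos th = 1/2\<close>. The cosine inequality
  gives \<open>r powr p * cos (p * th) >= (1/2) powr p\<close>, which is at least 1/2.\<close>

lemma Re_powr_half_line_ge:
  assumes "0 \<le> p" "p \<le> 1"
  shows "Re (Complex (1 / 2) t powr of_real p) \<ge> 1 / 2"
proof -
  let ?z = "Complex (1 / 2) t"
  have z: "?z \<noteq> 0"
    by (auto simp: complex_eq_iff)
  have arg: "\<bar>Im (Ln ?z)\<bar> < pi / 2"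
    using Re_Ln_pos_lt[OF z] by simp
  have "exp (Ln ?z) = ?z" using z by simp
  then have "Re (exp (Ln ?z)) = 1 / 2"
    by (metis complex.sel(1))
  then have half: "norm ?z * cos (Im (Ln ?z)) = 1 / 2"
    unfolding Re_exp using z by simp
  have "(norm ?z * cos (Im (Ln ?z))) powr p = norm ?z powr p * cos (Im (Ln ?z)) powr p"
    using arg by (simp add: powr_mult cos_ge_zero)
  also have "\<dots> \<le> norm ?z powr p * cos (p * Im (Ln ?z))"
    by (intro mult_left_mono cos_powr_le assms arg) auto
  also have "\<dots> = Re (?z powr of_real p)"
    using z by (simp add: powr_def Re_exp)
  finally have "(1 / 2) powr p \<le> Re (?z powr of_real p)"
    unfolding half .
  moreover have "(1 / 2) powr 1 \<le> (1 / 2 :: real) powr p"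
    using assms by (intro powr_mono') auto
  ultimately show ?thesis by simp
qed

text \<open>The mean value theorem in the exponent yields a cosine term and a sine term. The sine
  term has a favourable sign and is dropped, leaving \<open>Re (z powr x) * ln r\<close>.\<close>

lemma Re_powr_half_line_increment:
  assumes "0 < p" "p < q" "q \<le> 1"
  shows "Re (Complex (1 / 2) t powr of_real q) - Re (Complex (1 / 2) t powr of_real p) \<le> (q - p) * (t\<^sup>2 - 3 / 16)"
proof -
  let ?z = "Complex (1 / 2) t"
  define r where "r = norm ?z"
  define th where "th = Im (Ln ?z)"
  have z: "?z \<noteq> 0"
    by (auto simp: complex_eq_iff)
  have r: "r > 0" "r\<^sup>2 = 1 / 4 + t\<^sup>2"
    using z unfolding r_def by (simp, simp add: cmod_power2 power_divide)
  have th: "\<bar>th\<bar> < pi / 2"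
    using Re_Ln_pos_lt[OF z] by (simp add: th_def)
  have eq: "Re (?z powr of_real x) = exp (x * ln r) * cos (x * th)" for x
    using z by (simp add: powr_def Re_exp r_def th_def)
  have "\<exists>x>p. x < q \<and> exp (q * ln r) * cos (q * th) - exp (p * ln r) * cos (p * th) =
      (q - p) * (exp (x * ln r) * (cos (x * th) * ln r - th * sin (x * th)))"
    by (rule MVT2[OF assms(2)]) (auto intro!: derivative_eq_intros simp: algebra_simps)
  then obtain x where x: "p < x" "x < q" and eq2: "Re (?z powr of_real q) - Re (?z powr of_real p) =
      (q - p) * (exp (x * ln r) * (cos (x * th) * ln r - th * sin (x * th)))"
    unfolding eq by blast
  have "th * sin (x * th) \<ge> 0"
  proof -
    have sin: "y * sin (x * y) \<ge> 0" if "0 \<le> y" "y \<le> pi / 2" for y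
    proof -
      have "x * y \<le> y" "0 \<le> x * y"
        using x assms that mult_left_le_one_le[of y x] by auto
      then show ?thesis
        using that sin_ge_zero[of "x * y"] by (intro mult_nonneg_nonneg) auto
    qed
    show ?thesis
      using sin[of th] sin[of "- th"] th by (cases "th \<ge> 0") auto
  qed
  then have "exp (x * ln r) * (cos (x * th) * ln r - th * sin (x * th)) \<le> exp (x * ln r) * (cos (x * th) * ln r)"
    by (intro mult_left_mono) auto
  also have "\<dots> = Re (?z powr of_real x) * ln r"
    unfolding eq by simp
  also have "\<dots> \<le> t\<^sup>2 - 3 / 16"
  proof (cases "r \<le> 1")
    \<comment> \<open>Here \<open>ln r <= 0\<close>, so the lower bound 1/2 for the real part
      applies; \<open>2 * ln r <= t^2 - 3/4\<close> then produces the constant 3/16.\<close>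
    case True
    have "2 * ln r = ln (r\<^sup>2)"
      using ln_realpow[of r 2] r(1) by simp
    also have "\<dots> \<le> r\<^sup>2 - 1"
      using r(1) by (intro ln_le_minus_one) simp
    finally have "ln r \<le> (t\<^sup>2 - 3 / 4) / 2"
      using r by simp
    have "ln r \<le> 0"
      using True r by simp
    then have "Re (?z powr of_real x) * ln r \<le> 1 / 2 * ln r"
      using x assms by (intro mult_right_mono_neg Re_powr_half_line_ge) auto
    also have "\<dots> \<le> 1 / 2 * ((t\<^sup>2 - 3 / 4) / 2)"
      using \<open>ln r \<le> (t\<^sup>2 - 3 / 4) / 2\<close> by (intro mult_left_mono) auto
    also have "\<dots> \<le> t\<^sup>2 - 3 / 16"
      by simp
    finally show ?thesis .
  next
    \<comment> \<open>Now the modulus bounds the real part by \<open>r\<close>, and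
      \<open>r * (r - 1) <= r^2 - 1 = t^2 - 3/4\<close>.\<close>
    case False
    have "Re (?z powr of_real x) \<le> norm (?z powr of_real x)"
      by (rule complex_Re_le_cmod)
    also have "\<dots> = r powr x"
      using z by (simp add: powr_def r_def)
    also have "\<dots> \<le> r powr 1"
      using False x assms by (intro powr_mono) auto
    finally have "Re (?z powr of_real x) * ln r \<le> r * (r - 1)"
      using False ln_le_minus_one[of r] r by (intro mult_mono) auto
    also have "\<dots> = r\<^sup>2 - r"
      by (simp add: power2_eq_square algebra_simps)
    also have "\<dots> \<le> t\<^sup>2 - 3 / 16"
      using r False by linarith
    finally show ?thesis .
  qed
  finally show ?thesis
    unfolding eq2 using assms by (intro mult_left_mono) auto
qed

lemma continuous_on_Re_powr_line:
  "continuous_on A (\<lambda>t. sech2_kernel t * Re (Complex (1 / 2) t powr of_real p))"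
  by (intro continuous_intros) (auto simp: complex_nonpos_Reals_iff complex_eq_iff)

text \<open>Integrating the increment bound leaves second moment minus 3/16 of the mass. For
  \<open>N >= 1\<close> the mass is at least 3/5, and 1/9 is below 9/80.\<close>

lemma critical_mean_antimono:
  assumes "0 < p" "p < q" "q \<le> 1" "N \<ge> 1"
  shows "critical_mean q N \<le> critical_mean p N"
proof -
  have int: "(\<lambda>t. sech2_kernel t * Re (Complex (1 / 2) t powr of_real p)) integrable_on {- real N..real N}" for p
    by (intro integrable_continuous_real continuous_on_Re_powr_line)
  have W: "integral {- real N..real N} sech2_kernel = tanh (pi * real N)" "sech2_kernel integrable_on {- real N..real N}"
    using sech2_kernel_has_integral[of "- real N" "real N"] by (auto simp: has_integral_iff)
  have T: "(\<lambda>t. sech2_kernel t * t\<^sup>2) integrable_on {- real N..real N}"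
    by (intro integrable_continuous_real continuous_intros)
  have "critical_mean q N - critical_mean p N =
      integral {- real N..real N} (\<lambda>t. sech2_kernel t * Re (Complex (1 / 2) t powr of_real q)
                   - sech2_kernel t * Re (Complex (1 / 2) t powr of_real p))"
    unfolding critical_mean_def by (rule integral_diff[OF int int, symmetric])
  also have "\<dots> \<le> integral {- real N..real N} (\<lambda>t. (q - p) * (sech2_kernel t * t\<^sup>2 - 3 / 16 * sech2_kernel t))"
  proof (rule integral_le)
    fix t
    have "sech2_kernel t * (Re (Complex (1 / 2) t powr of_real q) - Re (Complex (1 / 2) t powr of_real p)) \<le>
        sech2_kernel t * ((q - p) * (t\<^sup>2 - 3 / 16))"
      using sech2_kernel_pos[of t] by (intro mult_left_mono Re_powr_half_line_increment assms) auto
    then show "sech2_kernel t * Re (Complex (1 / 2) t powr of_real q)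
                   - sech2_kernel t * Re (Complex (1 / 2) t powr of_real p) \<le> (q - p) * (sech2_kernel t * t\<^sup>2 - 3 / 16 * sech2_kernel t)"
      by (simp add: algebra_simps)
  qed (intro integrable_diff int integrable_continuous_real continuous_intros)+
  also have "\<dots> = (q - p) * (integral {- real N..real N} (\<lambda>t. sech2_kernel t * t\<^sup>2) - 3 / 16 * tanh (pi * real N))"
    using integral_diff[OF T integrable_on_cmult_left[OF W(2), of "3 / 16"]] by (simp add: W)
  also have "\<dots> \<le> 0"
  proof -
    have "(1::real) \<le> pi * real N"
      using mult_mono[of 1 pi 1 "real N"] pi_gt3 assms by simp
    then have "tanh (1::real) \<le> tanh (pi * real N)"
      by simp
    moreover have "tanh (1::real) \<ge> 3 / 5"
    proof -
      have "exp (2::real) \<ge> 1 + 2 + 2\<^sup>2 / 2"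
        by (rule exp_lower_Taylor_quadratic) simp
      then have "exp (- 2 * 1 :: real) \<le> 1 / 4"
        by (simp add: exp_minus field_simps)
      moreover have "3 / 5 \<le> (1 - e) / (1 + e)" if "0 < e" "e \<le> 1 / 4" for e :: real
        using that by (simp add: field_simps)
      ultimately show ?thesis
        unfolding tanh_real_altdef by (metis exp_gt_zero)
    qed
    ultimately have "integral {- real N..real N} (\<lambda>t. sech2_kernel t * t\<^sup>2) - 3 / 16 * tanh (pi * real N) \<le> 0"
      using sech2_kernel_moment[of N] by linarith
    then show ?thesis
      using assms by (intro mult_nonneg_nonpos) auto
  qed
  finally show ?thesis by simp
qed

lemma critical_mean_nonneg:
  assumes "0 \<le> p" "p \<le> 1"
  shows "critical_mean p N \<ge> 0"
  unfolding critical_mean_def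
proof (rule integral_nonneg)
  show "(\<lambda>t. sech2_kernel t * Re (Complex (1 / 2) t powr of_real p)) integrable_on {- real N..real N}"
    by (intro integrable_continuous_real continuous_on_Re_powr_line)
  show "0 \<le> sech2_kernel t * Re (Complex (1 / 2) t powr of_real p)" for t
    using sech2_kernel_pos[of t] Re_powr_half_line_ge[OF assms, of t] by simp
qed

lemma zeta_of_real:
  assumes "entire_mean (of_real s) = of_real M" "s \<noteq> 1"
  shows "zeta (of_real s) = of_real (M / (s - 1))"
  using assms by (simp add: zeta_eq)

lemma zeta_real: "Im (zeta (of_real s)) = 0"
proof (cases "s = 1")
  case False
  obtain M where "entire_mean (of_real s) = of_real M"
    by (rule entire_mean_real)
  from zeta_of_real[OF this False] show ?thesis
    by (simp only: Im_complex_of_real)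
qed (simp add: zeta_eq)

text \<open>Zeta at \<open>x\<close> is \<open>- X / (1 - x)\<close>. Moving right, the numerator
  \<open>X >= 0\<close> does not decrease and the denominator shrinks. Strictness is left to the
  entire part.\<close>

lemma Re_zeta_antimono:
  assumes "0 < x" "x < y" "y < 1"
  shows "Re (zeta (of_real y)) \<le> Re (zeta (of_real x))"
proof -
  obtain X where X: "entire_mean (of_real x) = of_real X" "critical_mean (1 - x) \<longlonglongrightarrow> X"
    by (rule entire_mean_real)
  obtain Y where Y: "entire_mean (of_real y) = of_real Y" "critical_mean (1 - y) \<longlonglongrightarrow> Y"
    by (rule entire_mean_real)
  have "X \<ge> 0"
    by (rule tendsto_lowerbound[OF X(2)]) (use assms in \<open>auto intro!: always_eventually critical_mean_nonneg\<close>)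
  have "X \<le> Y"
    by (rule tendsto_le[OF _ Y(2) X(2)])
       (use assms in \<open>auto intro!: eventually_mono[OF eventually_ge_at_top[of 1]] critical_mean_antimono\<close>)
  have "Re (zeta (of_real x)) = X / (x - 1)" "Re (zeta (of_real y)) = Y / (y - 1)"
    using zeta_of_real[OF X(1)] zeta_of_real[OF Y(1)] assms by (simp_all del: of_real_divide)
  then have "Re (zeta (of_real x)) = - (X / (1 - x))" "Re (zeta (of_real y)) = - (Y / (1 - y))"
    by (simp_all add: minus_divide_right)
  moreover have "X / (1 - x) \<le> Y / (1 - y)"
    using assms \<open>X \<ge> 0\<close> \<open>X \<le> Y\<close> by (intro frac_le) auto
  ultimately show ?thesis by simp
qed

subsection \<open>The entire part\<close>

lemma Re_zeta_sums:
  assumes "x > 1"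
  shows "(\<lambda>n. real (Suc n) powr (- x)) sums Re (zeta (of_real x))"
proof -
  have "of_nat (Suc n) powr (- of_real x) = (of_real (real (Suc n) powr (- x)) :: complex)" for n
    using powr_of_real[of "real (Suc n)" "- x"] by (simp del: of_nat_Suc)
  then show ?thesis
    using sums_Re[OF zeta_sums[of "of_real x"]] assms by (simp del: of_nat_Suc)
qed

lemma Re_zeta_ge_partial_sum:
  assumes "x > 1"
  shows "(\<Sum>n<k. real (Suc n) powr (- x)) \<le> Re (zeta (of_real x))"
  using Re_zeta_sums[OF assms] sum_le_suminf[of "\<lambda>n. real (Suc n) powr (- x)" "{..<k}"]
  by (auto simp: sums_iff simp del: of_nat_Suc)

section \<open>Coefficients of the entire part\<close>

definition E_coeff :: "nat \<Rightarrow> real" where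
  "E_coeff n = Re (zeta (of_nat (2 * Suc n))) - 1"

lemma Re_zeta_even:
  "Re (zeta (of_nat (2 * Suc n))) = Re (zeta (of_real (real (2 * Suc n))))"
  by (simp only: of_real_of_nat_eq)

lemma E_coeff_ge: "E_coeff n \<ge> (1 / 4) ^ Suc n"
proof -
  have "(\<Sum>k<2. real (Suc k) powr (- real (2 * Suc n))) = 1 + 2 powr (- real (2 * Suc n))"
    by (simp add: numeral_2_eq_2)
  also have "2 powr (- real (2 * Suc n)) = (1 / 4) ^ Suc n"
    by (subst powr_minus, subst powr_realpow)
       (simp_all only: power_mult zero_less_numeral power_one_over inverse_eq_divide, simp)
  finally show ?thesis
    using Re_zeta_ge_partial_sum[of "real (2 * Suc n)" 2]
    unfolding E_coeff_def Re_zeta_even by simp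
qed

lemma E_coeff_pos: "E_coeff n > 0"
  using E_coeff_ge[of n] by (rule less_le_trans[rotated]) simp

text \<open>The tail of the series for \<open>zeta 2\<close> is bounded below by the telescoping sum of
  \<open>1 / n - 1 / (n + 1)\<close>; the constant is slightly below \<open>pi\<^sup>2 / 6 - 1 = 0.6449\<dots>\<close>.\<close>

lemma E_coeff_0_ge: "E_coeff 0 \<ge> 119 / 200"
proof -
  have *: "1 + 1 / 4 + 1 / 9 + 1 / 16 + 1 / 5 - 1 / real (k + 5) \<le> (\<Sum>n<k + 4. 1 / (real (Suc n))\<^sup>2)" for k
  proof (induction k)
    case 0
    show ?case
      by (simp add: eval_nat_numeral)
  next
    case (Suc k)
    have "1 / real (k + 5) - 1 / real (Suc k + 5) \<le> 1 / (real (k + 5))\<^sup>2"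
      by (simp add: divide_simps power2_eq_square)
    moreover have "(\<Sum>n<Suc k + 4. 1 / (real (Suc n))\<^sup>2) =
        (\<Sum>n<k + 4. 1 / (real (Suc n))\<^sup>2) + 1 / (real (k + 5))\<^sup>2"
      by (simp add: numeral_eq_Suc)
    ultimately show ?case
      using Suc by linarith
  qed
  have "1 / (real (Suc n))\<^sup>2 = real (Suc n) powr (- 2)" for n
    by (simp add: powr_minus powr_numeral inverse_eq_divide del: of_nat_Suc)
  \<comment> \<open>At \<open>k = 30\<close> the telescoped bound is about 1.59504, just above 1 +
    119/200.\<close>
  then have "(\<Sum>n<30 + 4. 1 / (real (Suc n))\<^sup>2) \<le> Re (zeta (of_real 2))"
    using Re_zeta_ge_partial_sum[of 2 "30 + 4"] by simp
  then show ?thesis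
    using *[of 30] by (simp add: E_coeff_def)
qed

text \<open>Termwise: every base in the series is at least 2, so raising the exponent by
  \<open>2 * n\<close> costs at least a factor \<open>4 ^ n\<close>.\<close>

lemma E_coeff_le: "E_coeff n \<le> E_coeff 0 * (1 / 4) ^ n"
proof -
  have s: "(\<lambda>k. real (Suc (Suc k)) powr (- real (2 * Suc n))) sums E_coeff n" for n
    using sums_split_initial_segment[OF Re_zeta_sums[of "real (2 * Suc n)"], of 1]
    unfolding E_coeff_def Re_zeta_even by simp
  show ?thesis
  proof (rule sums_le[OF _ s sums_mult2[OF s]])
    fix k
    have "real (Suc (Suc k)) powr (- real (2 * Suc n)) = real (Suc (Suc k)) powr (- real (2 * Suc 0)) * real (Suc (Suc k)) powr (- real (2 * n))"
      by (simp flip: powr_add)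
    also have "real (Suc (Suc k)) powr (- real (2 * n)) \<le> 2 powr (- real (2 * n))"
      by (intro powr_mono2') auto
    also have "2 powr (- real (2 * n)) = (1 / 4) ^ n"
      by (subst powr_minus, subst powr_realpow)
         (simp_all only: power_mult zero_less_numeral power_one_over inverse_eq_divide, simp)
    finally show "real (Suc (Suc k)) powr (- real (2 * Suc n)) \<le> real (Suc (Suc k)) powr (- real (2 * Suc 0)) * (1 / 4) ^ n"
      by (simp add: mult_left_mono)
  qed
qed

section \<open>The entire part on the real axis\<close>

definition E_real :: "real \<Rightarrow> real" where
  "E_real x = (\<Sum>n. E_coeff n * real (Suc n) powr (- x))"

text \<open>A tangent to the logarithm bounds any fixed power of \<open>n + 1\<close> by a constant
  times \<open>exp n\<close>, so the terms are dominated by a geometric series of ratio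
  \<open>exp 1 / 4 < 1\<close>.\<close>

lemma summable_E_real: "summable (\<lambda>n. E_coeff n * real (Suc n) powr (- x))"
proof (rule summable_comparison_test')
  define A where "A = \<bar>x\<bar> + 1"
  define C where "C = E_coeff 0 * exp (1 + A * ln A)"
  have "exp 1 / 4 < (1::real)"
    using exp_le by simp
  then show "summable (\<lambda>n. C * (exp 1 / 4) ^ n)"
    by (intro summable_mult summable_geometric) auto
  fix n :: nat
  have A: "A \<ge> 1"
    by (simp add: A_def)
  then have "ln (real (Suc n) / A) \<le> real (Suc n) / A - 1"
    by (intro ln_le_minus_one) simp
  then have "A * (ln (real (Suc n)) - ln A) \<le> A * (real (Suc n) / A - 1)"
    using A by (intro mult_left_mono) (simp_all add: ln_div del: of_nat_Suc)
  then have "A * ln (real (Suc n)) \<le> real (Suc n) + A * ln A"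
    using A by (simp add: right_diff_distrib del: of_nat_Suc)
  then have "real (Suc n) powr A \<le> exp (real (Suc n) + A * ln A)"
    by (simp add: powr_def del: of_nat_Suc)
  moreover have "real (Suc n) powr (- x) \<le> real (Suc n) powr A"
    by (intro powr_mono) (auto simp: A_def)
  ultimately have "E_coeff n * real (Suc n) powr (- x) \<le> (E_coeff 0 * (1 / 4) ^ n) * exp (real (Suc n) + A * ln A)"
    using E_coeff_le[of n] E_coeff_pos[of n] E_coeff_pos[of 0] by (intro mult_mono) auto
  also have "\<dots> = C * (exp 1 / 4) ^ n"
    by (simp add: C_def power_divide exp_add exp_of_nat_mult[symmetric])
  finally show "norm (E_coeff n * real (Suc n) powr (- x)) \<le> C * (exp 1 / 4) ^ n"
    using E_coeff_pos[of n] by (simp add: abs_mult)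
qed

lemma E_of_real: "E (of_real x) = of_real (E_real x)"
proof -
  have "zeta (of_nat (2 * Suc n)) - 1 = of_real (E_coeff n)" for n
    using zeta_real[of "real (2 * Suc n)"] by (simp add: complex_eq_iff E_coeff_def)
  moreover have "of_nat (Suc n) powr (- of_real x) = (of_real (real (Suc n) powr (- x)) :: complex)" for n
    using powr_of_real[of "real (Suc n)" "- x"] by (simp del: of_nat_Suc)
  ultimately have "E (of_real x) = (\<Sum>n. of_real (E_coeff n * real (Suc n) powr (- x)))"
    unfolding E_def by simp
  also have "\<dots> = of_real (E_real x)"
    unfolding E_real_def by (rule suminf_of_real[OF summable_E_real, symmetric])
  finally show ?thesis .
qed

lemma E_real_strict_antimono:
  assumes "x < y"
  shows "E_real y < E_real x"
proof -
  let ?f = "\<lambda>n. E_coeff n * real (Suc n) powr (- x) - E_coeff n * real (Suc n) powr (- y)"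
  \<comment> \<open>The term at 0 has base 1 and does not depend on the argument; strictness comes
    from the term at 1, with base 2.\<close>
  have "0 < suminf ?f"
  proof (rule suminf_pos2[of _ 1])
    show "summable ?f"
      by (intro summable_diff summable_E_real)
    show "0 \<le> ?f n" for n
      using assms E_coeff_pos[of n] by (auto intro!: mult_left_mono powr_mono)
    show "0 < ?f 1"
      using assms E_coeff_pos[of 1] by simp
  qed
  also have "suminf ?f = E_real x - E_real y"
    unfolding E_real_def by (intro suminf_diff[symmetric] summable_E_real)
  finally show ?thesis by simp
qed

lemma E_real_nonneg: "E_real x \<ge> 0"
  unfolding E_real_def using E_coeff_pos
  by (intro suminf_nonneg summable_E_real) (auto simp: less_imp_le)

lemma continuous_on_E_real: "continuous_on {0..1} E_real"
  unfolding E_real_def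
proof (rule uniform_limit_theorem)
  show "uniform_limit {0..1} (\<lambda>N x. \<Sum>n<N. E_coeff n * real (Suc n) powr (- x))
     (\<lambda>x. \<Sum>n. E_coeff n * real (Suc n) powr (- x)) sequentially"
  proof (rule Weierstrass_m_test)
    show "summable E_coeff"
      using summable_E_real[of 0] by simp
    fix n and x :: real assume "x \<in> {0..1}"
    then have "real (Suc n) powr (- x) \<le> real (Suc n) powr 0"
      by (intro powr_mono) auto
    then show "norm (E_coeff n * real (Suc n) powr (- x)) \<le> E_coeff n"
      using E_coeff_pos[of n] by (simp add: abs_mult del: of_nat_Suc)
  qed
  show "\<forall>\<^sub>F N in sequentially. continuous_on {0..1} (\<lambda>x. \<Sum>n<N. E_coeff n * real (Suc n) powr (- x))"
    by (intro always_eventually allI continuous_intros) auto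
qed auto

text \<open>The target \<open>384 = 2 * 3 * 4^3\<close> is the case \<open>k = 1\<close> of the next
  estimate. The Taylor bound is taken at 1/8 and raised to the 48th power because it is too weak at
  6 itself.\<close>

lemma exp_6_ge: "exp (6::real) \<ge> 384"
proof -
  have "(145 / 128 :: real) \<le> exp (1 / 8)"
    using exp_lower_Taylor_quadratic[of "1 / 8 :: real"] by (simp add: power2_eq_square)
  then have "(145 / 128) ^ 48 \<le> exp (1 / 8 :: real) ^ 48"
    by (intro power_mono) auto
  also have "\<dots> = exp 6"
    by (simp flip: exp_of_nat_mult)
  finally have "(145 / 128) ^ 48 \<le> exp (6::real)" .
  moreover have "(384::real) \<le> (145 / 128) ^ 48"
    by (simp add: power_divide)
  ultimately show ?thesis
    by linarith
qed

text \<open>Lets the kernel's decay beyond height \<open>k\<close> be compared with the lower bound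
  \<open>(1/4) ^ (k + 2)\<close> for \<open>E_coeff (k + 1)\<close>.\<close>

lemma exp_2pi_ge:
  assumes "k \<ge> 1"
  shows "2 * real (k + 2) * 4 ^ (k + 2) \<le> exp (2 * pi * real k)"
proof -
  have "2 * real (k + 2) * 4 ^ (k + 2) \<le> exp (6::real) ^ k"
    using assms
  proof (induction k rule: dec_induct)
    case base
    then show ?case
      using exp_6_ge by simp
  next
    case (step k)
    have "2 * real (Suc k + 2) * 4 ^ (Suc k + 2) \<le> (2 * real (k + 2) * 4 ^ (k + 2)) * 384"
      by (simp add: field_simps)
    also have "\<dots> \<le> exp 6 ^ k * exp 6"
      using step.IH exp_6_ge by (intro mult_mono) auto
    finally show ?case
      by (simp add: mult.commute)
  qed
  also have "\<dots> = exp (6 * real k)"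
    by (simp add: mult.commute flip: exp_of_nat_mult)
  also have "\<dots> \<le> exp (2 * pi * real k)"
    using pi_gt3 by (simp add: mult_right_mono)
  finally show ?thesis .
qed

subsection \<open>The negative real axis\<close>

text \<open>The modulus of the integrand of Jensen's formula at \<open>s = - y\<close>, with
  \<open>sqrt (1/4 + t^2)\<close> as the modulus of \<open>1/2 + it\<close>.\<close>

definition modulus_integrand :: "real \<Rightarrow> real \<Rightarrow> real" where
  "modulus_integrand y t = sech2_kernel t * sqrt (1 / 4 + t\<^sup>2) powr (1 + y)"

lemma continuous_on_modulus_integrand: "continuous_on A (modulus_integrand y)"
proof -
  have "1 / 4 + t\<^sup>2 \<noteq> 0" for t :: real
    using zero_le_power2[of t] by linarith
  then show ?thesis
    unfolding modulus_integrand_def by (intro continuous_intros) auto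
qed

lemma abs_critical_mean_le:
  "\<bar>critical_mean (1 + y) N\<bar> \<le> 2 * integral {0..real N} (modulus_integrand y)"
proof -
  have "norm (critical_mean (1 + y) N) \<le> integral {- real N..real N} (modulus_integrand y)"
    unfolding critical_mean_def
  proof (rule integral_norm_bound_integral)
    fix t
    let ?z = "Complex (1 / 2) t"
    have "?z \<noteq> 0"
      by (auto simp: complex_eq_iff)
    then have "norm (?z powr of_real (1 + y)) = norm ?z powr (1 + y)"
      by (simp add: powr_def)
    also have "norm ?z = sqrt (1 / 4 + t\<^sup>2)"
      by (simp add: cmod_def power_divide)
    finally show "norm (sech2_kernel t * Re (?z powr of_real (1 + y))) \<le> modulus_integrand y t"
      using abs_Re_le_cmod[of "?z powr of_real (1 + y)"] sech2_kernel_pos[of t]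
      by (simp add: modulus_integrand_def abs_mult)
  qed (intro integrable_continuous_real continuous_on_Re_powr_line continuous_on_modulus_integrand)+
  also have "\<dots> = 2 * integral {0..real N} (modulus_integrand y)"
    by (intro integral_even continuous_on_modulus_integrand) (auto simp: modulus_integrand_def)
  finally show ?thesis by simp
qed

text \<open>The bound is made affine in \<open>2 powr y\<close> so that it can be compared with the
  first two terms of the entire part, \<open>E_coeff 0 + E_coeff 1 * 2 powr y\<close>.\<close>

lemma modulus_integral_first:
  assumes "y \<ge> 0"
  shows "2 * integral {0..1} (modulus_integrand y) \<le> 11 * (5 + 2 powr y) / 108"
proof -
  define c where "c = (5 + 2 powr y) / 6"
  have c: "c \<ge> 0"
    by (simp add: c_def)
  have "integral {0..1} (modulus_integrand y) \<le> integral {0..1} (\<lambda>t. c * (1 / 2 * sech2_kernel t + sech2_kernel t * t\<^sup>2))"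
  proof (rule integral_le)
    fix t :: real assume t: "t \<in> {0..1}"
    define r where "r = sqrt (1 / 4 + t\<^sup>2)"
    have "1 / 4 + t\<^sup>2 > 0"
      by (rule add_pos_nonneg) auto
    then have r: "r > 0" "r\<^sup>2 = 1 / 4 + t\<^sup>2"
      by (auto simp: r_def)
    have "r\<^sup>2 \<le> 5 / 4"
      using t r(2) by (simp add: abs_square_le_1)
    then have "(r\<^sup>2) ^ 3 \<le> (5 / 4) ^ 3"
      by (intro power_mono) auto
    then have "r ^ 6 \<le> 2"
      by (simp add: eval_nat_numeral field_simps)
    \<comment> \<open>From \<open>r ^ 6 <= 2\<close> follows \<open>r powr y <= u\<close>.
      Bernoulli's inequality for \<open>u ^ 6 = 2 powr y\<close> then gives
      \<open>u <= c\<close>.\<close>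
    define u :: real where "u = 2 powr (y / 6)"
    have "u > 0"
      by (simp add: u_def)
    have "(r ^ 6) powr (y / 6) = (r powr 6) powr (y / 6)"
      using r(1) by simp
    then have "r powr y = (r ^ 6) powr (y / 6)"
      unfolding powr_powr by simp
    also have "\<dots> \<le> u"
      unfolding u_def using \<open>r ^ 6 \<le> 2\<close> r assms by (intro powr_mono2) auto
    also have "u \<le> c"
    proof -
      have "u ^ 6 = u powr 6"
        using \<open>u > 0\<close> by simp
      also have "\<dots> = 2 powr y"
        unfolding u_def powr_powr by simp
      finally show ?thesis
        using Bernoulli_inequality[of "u - 1" 6] \<open>u > 0\<close> by (simp add: c_def)
    qed
    finally have "r powr y \<le> c" .
    \<comment> \<open>Expanding \<open>(r - 1/2)^2 >= 0\<close> replaces the square root by a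
      polynomial, so only mass and second moment are needed.\<close>
    have "r \<le> 1 / 2 + t\<^sup>2"
      using r(2) zero_le_power2[of "r - 1 / 2"] by (simp add: power2_eq_square algebra_simps)
    have "r powr (1 + y) = r * r powr y"
      using r by (simp add: powr_add)
    also have "\<dots> \<le> (1 / 2 + t\<^sup>2) * c"
      using \<open>r powr y \<le> c\<close> \<open>r \<le> 1 / 2 + t\<^sup>2\<close> r by (intro mult_mono) auto
    finally have "sech2_kernel t * r powr (1 + y) \<le> sech2_kernel t * ((1 / 2 + t\<^sup>2) * c)"
      using sech2_kernel_pos[of t] by (intro mult_left_mono) auto
    then show "modulus_integrand y t \<le> c * (1 / 2 * sech2_kernel t + sech2_kernel t * t\<^sup>2)"
      by (simp add: modulus_integrand_def r_def algebra_simps)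
  qed (intro integrable_continuous_real continuous_on_modulus_integrand continuous_intros)+
  also have "\<dots> = c * (1 / 2 * integral {0..1} sech2_kernel + integral {0..1} (\<lambda>t. sech2_kernel t * t\<^sup>2))"
  proof -
    have "integral {0..1} (\<lambda>t. 1 / 2 * sech2_kernel t + sech2_kernel t * t\<^sup>2) =
        integral {0..1} (\<lambda>t. 1 / 2 * sech2_kernel t) + integral {0..1} (\<lambda>t. sech2_kernel t * t\<^sup>2)"
      by (rule Henstock_Kurzweil_Integration.integral_add)
         (intro integrable_continuous_real continuous_intros)+
    then show ?thesis
      by (simp only: Henstock_Kurzweil_Integration.integral_mult_right)
  qed
  also have "\<dots> \<le> c * (1 / 2 * (1 / 2) + 1 / 18)"
  proof (intro mult_left_mono add_mono c)
    have "integral {0..1} sech2_kernel = tanh pi / 2"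
      using sech2_kernel_has_integral[of 0 1] by (simp add: integral_unique)
    then show "integral {0..1} sech2_kernel \<le> 1 / 2"
      using tanh_real_lt_1[of pi] by simp
    show "integral {0..1} (\<lambda>t. sech2_kernel t * t\<^sup>2) \<le> 1 / 18"
      using sech2_kernel_half_moment[of 1] by simp
  qed auto
  finally show ?thesis
    by (simp add: c_def field_simps)
qed

text \<open>On this interval the modulus is at most \<open>k + 2\<close> and the exponential
  majorant integrates to at most \<open>exp (- (2 * pi * k))\<close>. The latter, even times
  \<open>2 * (k + 2)\<close>, is below the coefficient.\<close>

lemma modulus_integral_step:
  assumes "y \<ge> 0" "k \<ge> 1"
  shows "2 * integral {real k..real k + 1} (modulus_integrand y) \<le> (1 + y) * (E_coeff (k + 1) * real (k + 2) powr y)"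
proof -
  define P where "P = real (k + 2) powr (1 + y)"
  have int: "((\<lambda>t. P * (2 * pi * exp (- (2 * pi * t)))) has_integral
      (- P * exp (- (2 * pi * (real k + 1))) - - P * exp (- (2 * pi * real k)))) {real k..real k + 1}"
  proof (rule fundamental_theorem_of_calculus)
    fix t
    have "((\<lambda>t. - P * exp (- (2 * pi * t))) has_real_derivative P * (2 * pi * exp (- (2 * pi * t)))) (at t within {real k..real k + 1})"
      by (auto intro!: derivative_eq_intros)
    then show "((\<lambda>t. - P * exp (- (2 * pi * t))) has_vector_derivative P * (2 * pi * exp (- (2 * pi * t)))) (at t within {real k..real k + 1})"
      by (simp add: has_real_derivative_iff_has_vector_derivative)
  qed auto
  have "integral {real k..real k + 1} (modulus_integrand y) \<le> integral {real k..real k + 1} (\<lambda>t. P * (2 * pi * exp (- (2 * pi * t))))"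
  proof (rule integral_le)
    fix t assume t: "t \<in> {real k..real k + 1}"
    have "1 / 4 + t\<^sup>2 \<le> (real (k + 2))\<^sup>2"
    proof -
      have "t\<^sup>2 \<le> (real k + 1)\<^sup>2"
        using t by (intro power_mono) auto
      then show ?thesis
        by (simp add: power2_eq_square algebra_simps)
    qed
    then have "sqrt (1 / 4 + t\<^sup>2) \<le> real (k + 2)"
      by (rule real_le_lsqrt[rotated -1]) auto
    then have "sqrt (1 / 4 + t\<^sup>2) powr (1 + y) \<le> P"
      unfolding P_def using assms by (intro powr_mono2) auto
    moreover have "sech2_kernel t \<le> 2 * pi * exp (- (2 * pi * t))"
      using sech2_kernel_le[of t] t by simp
    ultimately have "sech2_kernel t * sqrt (1 / 4 + t\<^sup>2) powr (1 + y) \<le> (2 * pi * exp (- (2 * pi * t))) * P"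
      by (intro mult_mono) auto
    then show "modulus_integrand y t \<le> P * (2 * pi * exp (- (2 * pi * t)))"
      by (simp add: modulus_integrand_def mult_ac)
  qed (intro integrable_continuous_real continuous_on_modulus_integrand has_integral_integrable[OF int])+
  also have "\<dots> \<le> P * exp (- (2 * pi * real k))"
    using integral_unique[OF int] by (simp add: P_def)
  also have "\<dots> = real (k + 2) powr y * (real (k + 2) * exp (- (2 * pi * real k)))"
    by (simp add: P_def powr_add)
  finally have "2 * integral {real k..real k + 1} (modulus_integrand y) \<le>
      2 * (real (k + 2) powr y * (real (k + 2) * exp (- (2 * pi * real k))))"
    by (rule mult_left_mono) simp
  then have 1: "2 * integral {real k..real k + 1} (modulus_integrand y) \<le>
      real (k + 2) powr y * (2 * real (k + 2) * exp (- (2 * pi * real k)))"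
    by (simp only: mult_ac)
  have "2 * real (k + 2) * exp (- (2 * pi * real k)) \<le> (1 / 4) ^ (k + 2)"
    using exp_2pi_ge[OF assms(2)] by (simp add: exp_minus power_divide field_simps del: of_nat_add)
  also have "\<dots> \<le> 1 * E_coeff (k + 1)"
    using E_coeff_ge[of "k + 1"] by simp
  also have "\<dots> \<le> (1 + y) * E_coeff (k + 1)"
    using assms E_coeff_pos[of "k + 1"] by (intro mult_right_mono) auto
  finally have "real (k + 2) powr y * (2 * real (k + 2) * exp (- (2 * pi * real k))) \<le> real (k + 2) powr y * ((1 + y) * E_coeff (k + 1))"
    by (intro mult_left_mono) auto
  from order.trans[OF 1 this] show ?thesis
    by (simp only: mult_ac)
qed

text \<open>The unit interval starting at \<open>k >= 1\<close> consumes the term at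
  \<open>k + 1\<close>, so the terms at 0 and 1 stay available for the interval from 0 to 1.\<close>

lemma modulus_integral_le:
  assumes "y \<ge> 0" "N \<ge> 1"
  shows "2 * integral {0..real N} (modulus_integrand y) \<le>
    11 * (5 + 2 powr y) / 108 + (1 + y) * (\<Sum>n\<in>{2..<Suc N}. E_coeff n * real (Suc n) powr y)"
  using assms(2)
proof (induction N rule: dec_induct)
  case base
  then show ?case
    using modulus_integral_first[OF assms(1)] by simp
next
  case (step k)
  have "integral {0..real (Suc k)} (modulus_integrand y) =
      integral {0..real k} (modulus_integrand y) + integral {real k..real k + 1} (modulus_integrand y)"
    using Henstock_Kurzweil_Integration.integral_combine[of 0 "real k" "real k + 1" "modulus_integrand y"]
    by (simp add: integrable_continuous_real continuous_on_modulus_integrand add.commute)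
  moreover have "(\<Sum>n\<in>{2..<Suc (Suc k)}. E_coeff n * real (Suc n) powr y) =
      (\<Sum>n\<in>{2..<Suc k}. E_coeff n * real (Suc n) powr y) + E_coeff (k + 1) * real (k + 2) powr y"
    using step(1) by (subst sum.atLeastLessThan_Suc) auto
  ultimately show ?case
    using step.IH modulus_integral_step[OF assms(1) step(1)] by (simp only: ring_distribs)
qed

lemma D_real_pos_left:
  assumes "x \<le> 0"
  shows "Re (D (of_real x)) > 0"
proof -
  define y where "y = - x"
  have y: "y \<ge> 0"
    using assms by (simp add: y_def)
  \<comment> \<open>Bounds the mean by the contribution of the first interval plus
    \<open>1 + y\<close> times the entire part without its first two terms.\<close>
  define B where "B = 11 * (5 + 2 powr y) / 108 + (1 + y) * (E_real x - E_coeff 0 - E_coeff 1 * 2 powr y)"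
  obtain M where M: "entire_mean (of_real x) = of_real M" "critical_mean (1 - x) \<longlonglongrightarrow> M"
    by (rule entire_mean_real)
  have "\<bar>critical_mean (1 - x) N\<bar> \<le> B" if "N \<ge> 1" for N
  proof -
    have "\<bar>critical_mean (1 + y) N\<bar> \<le> 11 * (5 + 2 powr y) / 108 + (1 + y) * (\<Sum>n\<in>{2..<Suc N}. E_coeff n * real (Suc n) powr y)"
      using abs_critical_mean_le[of y N] modulus_integral_le[OF y that] by linarith
    also have "(\<Sum>n\<in>{2..<Suc N}. E_coeff n * real (Suc n) powr y) \<le> E_real x - E_coeff 0 - E_coeff 1 * 2 powr y"
    proof -
      have "(\<Sum>n<Suc N. E_coeff n * real (Suc n) powr y) \<le> E_real x"
        unfolding E_real_def y_def using E_coeff_pos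
        by (intro sum_le_suminf summable_E_real) (auto simp: less_imp_le)
      moreover have "{..<Suc N} = {0, 1} \<union> {2..<Suc N}"
        using that by auto
      then have "(\<Sum>n<Suc N. E_coeff n * real (Suc n) powr y) =
          E_coeff 0 + E_coeff 1 * 2 powr y + (\<Sum>n\<in>{2..<Suc N}. E_coeff n * real (Suc n) powr y)"
        by (simp add: sum.union_disjoint del: sum.lessThan_Suc)
      ultimately show ?thesis by linarith
    qed
    finally show ?thesis
      using y by (simp add: B_def y_def mult_left_mono)
  qed
  then have "\<bar>M\<bar> \<le> B"
    by (intro tendsto_upperbound[OF tendsto_rabs[OF M(2)]] eventually_mono[OF eventually_ge_at_top[of 1]]) auto
  moreover have "11 * (5 + 2 powr y) / 108 < (1 + y) * (E_coeff 0 + E_coeff 1 * 2 powr y)"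
  proof -
    define v :: real where "v = 2 powr y"
    have "v \<ge> 0" by (simp add: v_def)
    then have "1 / 16 * v \<le> E_coeff 1 * v"
      using E_coeff_ge[of 1] by (intro mult_right_mono) (simp_all add: power2_eq_square)
    then have E01: "119 / 200 + v / 16 \<le> E_coeff 0 + E_coeff 1 * v"
      using E_coeff_0_ge by simp
    have "11 * (5 + v) / 108 < (1 + y) * (119 / 200 + v / 16)"
    \<comment> \<open>For \<open>y <= 1\<close> we have \<open>v <= 2\<close>, and the tightest case
      \<open>v = 2\<close> reads 77/108 < 0.72. For \<open>y > 1\<close> the factor
      \<open>1 + y\<close> exceeds 2, which makes the slope in \<open>v\<close> on the right the
      larger one.\<close>
    proof (cases "y \<le> 1")
      case True
      then have "v \<le> 2 powr 1"
        unfolding v_def by (intro powr_mono) auto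
      then have "11 * (5 + v) / 108 < 1 * (119 / 200 + v / 16)"
        by simp
      also have "\<dots> \<le> (1 + y) * (119 / 200 + v / 16)"
        using y \<open>v \<ge> 0\<close> by (intro mult_right_mono) auto
      finally show ?thesis .
    next
      case False
      have "11 * (5 + v) / 108 < 2 * (119 / 200 + v / 16)"
        using \<open>v \<ge> 0\<close> by simp
      also have "\<dots> \<le> (1 + y) * (119 / 200 + v / 16)"
        using False \<open>v \<ge> 0\<close> by (intro mult_right_mono) auto
      finally show ?thesis .
    qed
    also have "\<dots> \<le> (1 + y) * (E_coeff 0 + E_coeff 1 * v)"
      using E01 y by (intro mult_left_mono) auto
    finally show ?thesis
      by (simp add: v_def)
  qed
  moreover have "B = 11 * (5 + 2 powr y) / 108 + (1 + y) * E_real x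
      - (1 + y) * (E_coeff 0 + E_coeff 1 * 2 powr y)"
    by (simp add: B_def algebra_simps)
  ultimately have "M < (1 + y) * E_real x"
    by linarith
  moreover have "Re (D (of_real x)) = E_real x - M / (1 + y)"
    using zeta_of_real[OF M(1)] assms
    by (simp add: D_def E_of_real y_def minus_divide_right del: of_real_divide)
  moreover have "M / (1 + y) < E_real x"
    using \<open>M < (1 + y) * E_real x\<close> y by (simp add: pos_divide_less_eq mult.commute)
  ultimately show ?thesis
    by simp
qed

section \<open>Zeros on the real axis\<close>

lemma D_real_pos_right:
  assumes "x > 1"
  shows "Re (D (of_real x)) > 0"
  using Re_zeta_ge_partial_sum[OF assms, of 1] E_real_nonneg[of x] by (simp add: D_def E_of_real)

lemma D_real_zero_exists: "\<exists>\<rho>\<in>{0<..<1}. Re (D (of_real \<rho>)) = 0"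
proof -
  txt \<open>Multiplying by \<open>x - 1\<close> removes the pole and makes the intermediate value theorem
    applicable on the closed interval.\<close>
  define \<phi> where "\<phi> = (\<lambda>x. Re (entire_mean (of_real x)) + (x - 1) * E_real x)"
  have D: "Re (D (of_real x)) = \<phi> x / (x - 1)" if "x \<noteq> 1" for x
  proof -
    obtain M where M: "entire_mean (of_real x) = of_real M"
      by (rule entire_mean_real)
    show ?thesis
      using zeta_of_real[OF M that] that M
      by (simp add: D_def E_of_real \<phi>_def add_divide_distrib del: of_real_divide)
  qed
  have "continuous_on {0..1} (\<lambda>x::real. entire_mean (of_real x))"
    by (rule continuous_on_compose2[OF holomorphic_on_imp_continuous_on[OF entire_mean_holomorphic]])
       (auto intro: continuous_on_of_real_id)
  then have "continuous_on {0..1} \<phi>"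
    unfolding \<phi>_def by (intro continuous_intros continuous_on_E_real)
  \<comment> \<open>Positivity of \<open>D\<close> at 0 becomes negativity because the factor
    \<open>x - 1\<close> is -1 there.\<close>
  moreover have "\<phi> 0 < 0"
    using D[of 0] D_real_pos_left[of 0] by simp
  moreover have "\<phi> 1 = 1"
    by (simp add: \<phi>_def entire_mean_1)
  ultimately obtain \<rho> where \<rho>: "0 \<le> \<rho>" "\<rho> \<le> 1" "\<phi> \<rho> = 0"
    using IVT'[of \<phi> 0 0 1] by auto
  then have "\<rho> \<noteq> 0" "\<rho> \<noteq> 1"
    using \<open>\<phi> 0 < 0\<close> \<open>\<phi> 1 = 1\<close> by auto
  then show ?thesis
    using \<rho> D[of \<rho>] by (intro bexI[of _ \<rho>]) auto
qed

theorem proposition4p3: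
  "strict_antimono_on {0<..<1} (\<lambda>x::real. Re (D (of_real x))) \<and>
   (\<exists>\<rho>\<^sub>0\<in>{0<..<1}. {x::real. x \<noteq> 1 \<and> D (of_real x) = 0} = {\<rho>\<^sub>0})"
proof
  \<comment> \<open>Zeta contributes only weak monotonicity; the entire part makes the inequality
    strict.\<close>
  have less: "Re (D (of_real y)) < Re (D (of_real x))" if "0 < x" "x < y" "y < 1" for x y
    using Re_zeta_antimono[OF that] E_real_strict_antimono[OF that(2)] by (simp add: D_def E_of_real)
  then show "strict_antimono_on {0<..<1} (\<lambda>x::real. Re (D (of_real x)))"
    by (auto simp: monotone_on_def)
  obtain \<rho> where \<rho>: "\<rho> \<in> {0<..<1}" "Re (D (of_real \<rho>)) = 0"
    using D_real_zero_exists by blast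
  have "D (of_real x) = 0 \<longleftrightarrow> Re (D (of_real x)) = 0" for x
    by (simp add: complex_eq_iff D_def E_of_real zeta_real)
  \<comment> \<open>Positivity of \<open>D\<close> at nonpositive arguments and to the right of 1
    forces a zero into the unit interval, where strict monotonicity allows only one.\<close>
  moreover have "x = \<rho>" if "x \<noteq> 1" "Re (D (of_real x)) = 0" for x
  proof -
    have "0 < x" "x < 1"
      using that D_real_pos_left[of x] D_real_pos_right[of x] by force+
    then show ?thesis
      using less[of x \<rho>] less[of \<rho> x] \<rho> that by (cases x \<rho> rule: linorder_cases) auto
  qed
  ultimately have "{x::real. x \<noteq> 1 \<and> D (of_real x) = 0} = {\<rho>}"
    using \<rho> by auto
  then show "\<exists>\<rho>\<^sub>0\<in>{0<..<1}. {x::real. x \<noteq> 1 \<and> D (of_real x) = 0} = {\<rho>\<^sub>0}"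
    using \<rho>(1) by blast
qed

end
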